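(* Let $(M,\mathcal T,\Phi)$ be a weighted triangulated surface with $M$ connected, let $\alpha\in\mathbb R$, and suppose $\alpha\chi(M)\le 0$. Let $r(0)\in\mathbb R^N_{>0}$ be an initial circle packing metric with $\prod_{i=1}^N r_i(0)=1$ and let $r(t)$ be the solution of the $\alpha$-flow $$\frac{du_i}{dt}=s_\alpha r_i^\alpha-K_i,\qquad u_i=\ln r_i,\quad 1\le i\le N,$$ starting at $r(0)$. Then $r(t)$ converges as $t\to+\infty$ if and only if there exists a constant $\alpha$-curvature metric $r^*$ on $(M,\mathcal T,\Phi)$. Furthermore, if the solution converges, then it converges exponentially fast to a metric of constant $\alpha$-curvature.
   Context: $M$ is a closed surface with a triangulation $\mathcal T=\{V,E,F\}$ (vertices, edges, faces), $V=\{1,\dots,N\}$, and $\Phi:E\to[0,\pi/2]$ is a weight, $\Phi_{ij}$ being its value on the edge $\{ij\}$; $(M,\mathcal T,\Phi)$ is called a weighted triangulated surface. $\chi(M)$ is the Euler characteristic. A circle packing metric is a map $r:V\to(0,+\infty)$, i.e. $r=(r_1,\dots,r_N)\in\mathbb R^N_{>0}$. It gives each edge $\{ij\}$ the length $l_{ij}=\sqrt{r_i^2+r_j^2+2r_ir_j\cos\Phi_{ij}}$; for each face $\{ijk\}$ the three lengths satisfy the strict triangle inequalities, so the face is realized as a Euclidean triangle; $\theta_i^{jk}$ denotes its inner angle at $i$. The classical discrete Gauss curvature is $K_i=2\pi-\sum_{\{ijk\}\in F}\theta_i^{jk}$ (sum over all triangles having $i$ as a vertex). For $\alpha\in\mathbb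 R$, the $\alpha$-curvature at $i$ is $R_{\alpha,i}=K_i/r_i^\alpha$; $r$ is a constant $\alpha$-curvature metric if $R_{\alpha,i}$ does not depend on $i$. Write $\|r\|_\alpha^\alpha=\sum_{i=1}^N r_i^\alpha$ and $s_\alpha=2\pi\chi(M)/\|r\|_\alpha^\alpha$. "$r(t)$ converges" means that $r(t)$ tends to a point of $\mathbb R^N_{>0}$ as $t\to+\infty$; "exponentially fast" means the distance to the limit is at most $Ce^{-ct}$ for some constants $C,c>0$ and all $t\ge0$. *)

theory Defs
  imports "HOL-Analysis.Analysis"
begin

section \<open>Triangulated closed surfaces\<close>

text \<open>
  Second countability is not listed: it follows from compactness and local Euclideanness.
\<close>

definition closed_surface :: "'m topology \<Rightarrow> bool" where
  "closed_surface M \<longleftrightarrow>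
     compact_space M \<and> Hausdorff_space M \<and>
     (\<forall>p \<in> topspace M. \<exists>U W. openin M U \<and> p \<in> U \<and> open (W :: (real ^ 2) set) \<and>
        subtopology M U homeomorphic_space top_of_set W)"

text \<open>
  The vertex set of a triangulation is the whole finite type \<open>'v\<close>, so that \<open>N = CARD('v)\<close> and
  the space of vertex functions is \<open>real ^ 'v\<close>. Edges and faces are recorded as sets of vertices.
\<close>

definition simplicial_2_complex :: "'v::finite set set \<Rightarrow> 'v set set \<Rightarrow> bool" where
  "simplicial_2_complex E F \<longleftrightarrow>
     (\<forall>e\<in>E. card e = 2) \<and> (\<forall>f\<in>F. card f = 3) \<and>
     (\<forall>f\<in>F. \<forall>e. e \<subseteq> f \<and> card e = 2 \<longrightarrow> e \<in> E)"

text \<open>Points of the realization are given by their barycentric coordinates.\<close>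

definition geometric_realization :: "'v::finite set set \<Rightarrow> 'v set set \<Rightarrow> (real ^ 'v) set" where
  "geometric_realization E F =
     {x. (\<forall>i. 0 \<le> x $ i) \<and> (\<Sum>i\<in>UNIV. x $ i) = 1 \<and>
         {i. x $ i \<noteq> 0} \<in> range (\<lambda>i. {i}) \<union> E \<union> F}"

definition triangulates :: "'v::finite set set \<Rightarrow> 'v set set \<Rightarrow> 'm topology \<Rightarrow> bool" where
  "triangulates E F M \<longleftrightarrow>
     simplicial_2_complex E F \<and>
     top_of_set (geometric_realization E F) homeomorphic_space M"

definition weighted_triangulated_surface ::
  "'m topology \<Rightarrow> 'v::finite set set \<Rightarrow> 'v set set \<Rightarrow> ('v set \<Rightarrow> real) \<Rightarrow> bool" where
  "weighted_triangulated_surface M E F \<Phi> \<longleftrightarrow>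
     closed_surface M \<and> triangulates E F M \<and> (\<forall>e\<in>E. 0 \<le> \<Phi> e \<and> \<Phi> e \<le> pi / 2)"

text \<open>\<open>\<chi>(M)\<close>, computed from the triangulation as vertices minus edges plus faces.\<close>

definition euler_char :: "'v::finite set set \<Rightarrow> 'v set set \<Rightarrow> int" where
  "euler_char E F = int CARD('v) - int (card E) + int (card F)"


section \<open>Circle packing metrics and curvature\<close>

definition circle_packing_metric :: "real ^ 'v::finite \<Rightarrow> bool" where
  "circle_packing_metric r \<longleftrightarrow> (\<forall>i. 0 < r $ i)"

definition edge_length :: "('v set \<Rightarrow> real) \<Rightarrow> real ^ 'v::finite \<Rightarrow> 'v \<Rightarrow> 'v \<Rightarrow> real" where
  "edge_length \<Phi> r i j =
     sqrt ((r $ i)\<^sup>2 + (r $ j)\<^sup>2 + 2 * r $ i * r $ j * cos (\<Phi> {i, j}))"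

text \<open>
  The angle enclosed by the sides \<open>a\<close>, \<open>b\<close> of a Euclidean triangle whose third side is \<open>c\<close>, by
  the law of cosines; \<open>triangle_angle_realized\<close> relates it to triangles given by points.
\<close>

definition triangle_angle :: "real \<Rightarrow> real \<Rightarrow> real \<Rightarrow> real" where
  "triangle_angle a b c = arccos ((a\<^sup>2 + b\<^sup>2 - c\<^sup>2) / (2 * a * b))"

lemma triangle_angle_realized:
  fixes A B C :: "'a::real_inner"
  shows "triangle_angle (dist A B) (dist A C) (dist B C) =
    arccos (inner (B - A) (C - A) / (norm (B - A) * norm (C - A)))"
proof -
  have "B - C = (B - A) - (C - A)"
    by simp
  then have "(dist A B)\<^sup>2 + (dist A C)\<^sup>2 - (dist B C)\<^sup>2 = 2 * inner (B - A) (C - A)"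
    by (metis (no_types, lifting) dist_commute dist_norm dot_norm_neg
        nonzero_mult_div_cancel_left times_divide_eq_right zero_neq_numeral)
  then show ?thesis
    by (simp add: triangle_angle_def dist_norm norm_minus_commute)
qed

definition inner_angle ::
  "('v set \<Rightarrow> real) \<Rightarrow> real ^ 'v::finite \<Rightarrow> 'v \<Rightarrow> 'v \<Rightarrow> 'v \<Rightarrow> real" where
  "inner_angle \<Phi> r i j k =
     triangle_angle (edge_length \<Phi> r i j) (edge_length \<Phi> r i k) (edge_length \<Phi> r j k)"

text \<open>
  The inner angle at \<open>i\<close> of the face \<open>f\<close>. The two ways of naming the remaining vertices
  give the same angle, see \<open>face_angle_eq\<close>.
\<close>

definition face_angle ::
  "('v set \<Rightarrow> real) \<Rightarrow> real ^ 'v::finite \<Rightarrow> 'v set \<Rightarrow> 'v \<Rightarrow> real" where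
  "face_angle \<Phi> r f i = (THE \<theta>. \<exists>j k. f = {i, j, k} \<and> \<theta> = inner_angle \<Phi> r i j k)"

lemma edge_length_commute: "edge_length \<Phi> r i j = edge_length \<Phi> r j i"
  by (simp add: edge_length_def insert_commute algebra_simps)

lemma inner_angle_commute: "inner_angle \<Phi> r i j k = inner_angle \<Phi> r i k j"
  by (simp add: inner_angle_def triangle_angle_def edge_length_commute[of _ _ j k] algebra_simps)

lemma face_angle_eq:
  assumes "card {i, j, k} = 3"
  shows "face_angle \<Phi> r {i, j, k} i = inner_angle \<Phi> r i j k"
proof -
  have d: "i \<noteq> j" "i \<noteq> k" "j \<noteq> k"
    using assms by (auto simp: card_insert_if split: if_splits)
  have "inner_angle \<Phi> r i j' k' = inner_angle \<Phi> r i j k" if "{i, j, k} = {i, j', k'}" for j' k'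
  proof -
    have "(j' = j \<and> k' = k) \<or> (j' = k \<and> k' = j)"
      using that d unfolding set_eq_iff insert_iff empty_iff by metis
    then show ?thesis
      using inner_angle_commute by metis
  qed
  then show ?thesis
    unfolding face_angle_def by (intro the_equality) (blast, metis)
qed

definition gauss_curvature ::
  "'v set set \<Rightarrow> ('v set \<Rightarrow> real) \<Rightarrow> real ^ 'v::finite \<Rightarrow> 'v \<Rightarrow> real" where
  "gauss_curvature F \<Phi> r i = 2 * pi - (\<Sum>f \<in> {f \<in> F. i \<in> f}. face_angle \<Phi> r f i)"

definition alpha_curvature ::
  "'v set set \<Rightarrow> ('v set \<Rightarrow> real) \<Rightarrow> real \<Rightarrow> real ^ 'v::finite \<Rightarrow> 'v \<Rightarrow> real" where
  "alpha_curvature F \<Phi> \<alpha> r i = gauss_curvature F \<Phi> r i / (r $ i) powr \<alpha>"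

definition constant_alpha_curvature_metric ::
  "'v set set \<Rightarrow> ('v set \<Rightarrow> real) \<Rightarrow> real \<Rightarrow> real ^ 'v::finite \<Rightarrow> bool" where
  "constant_alpha_curvature_metric F \<Phi> \<alpha> r \<longleftrightarrow>
     circle_packing_metric r \<and> (\<exists>c. \<forall>i. alpha_curvature F \<Phi> \<alpha> r i = c)"


section \<open>The flow\<close>

definition s_alpha :: "'v set set \<Rightarrow> 'v set set \<Rightarrow> real \<Rightarrow> real ^ 'v::finite \<Rightarrow> real" where
  "s_alpha E F \<alpha> r = 2 * pi * euler_char E F / (\<Sum>i\<in>UNIV. (r $ i) powr \<alpha>)"

definition alpha_flow_solution ::
  "'v set set \<Rightarrow> 'v set set \<Rightarrow> ('v set \<Rightarrow> real) \<Rightarrow> real \<Rightarrow> (real \<Rightarrow> real ^ 'v::finite) \<Rightarrow> bool" where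
  "alpha_flow_solution E F \<Phi> \<alpha> r \<longleftrightarrow>
     (\<forall>t\<ge>0. circle_packing_metric (r t) \<and>
       (\<forall>i. ((\<lambda>\<tau>. ln (r \<tau> $ i)) has_real_derivative
               s_alpha E F \<alpha> (r t) * (r t $ i) powr \<alpha> - gauss_curvature F \<Phi> (r t) i)
             (at t within {0..})))"

text \<open>The limit has to be a metric again: leaving the positive orthant is not convergence.\<close>

definition flow_converges_to :: "(real \<Rightarrow> real ^ 'v::finite) \<Rightarrow> real ^ 'v \<Rightarrow> bool" where
  "flow_converges_to r r' \<longleftrightarrow> circle_packing_metric r' \<and> (r \<longlongrightarrow> r') at_top"

definition flow_converges_exponentially_to ::
  "(real \<Rightarrow> real ^ 'v::finite) \<Rightarrow> real ^ 'v \<Rightarrow> bool" where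
  "flow_converges_exponentially_to r r' \<longleftrightarrow>
     flow_converges_to r r' \<and>
     (\<exists>C>0. \<exists>c>0. \<forall>t\<ge>0. dist (r t) r' \<le> C * exp (- c * t))"

end

theory Submission
  imports Defs
begin

text \<open>
  In the coordinates \<open>u\<^sub>i = ln r\<^sub>i\<close> the \<open>\<alpha>\<close>-flow is \<open>u' = V(u)\<close> with
  \<open>V\<^sub>i = s\<^sub>\<alpha> r\<^sub>i\<^sup>\<alpha> - K\<^sub>i\<close>, and the theorem rests on the monotonicity of \<open>- V\<close>: the flow is a
  contraction, and a zero of \<open>V\<close> attracts it.

  In a single face the Jacobian of the angles is symmetric with nonnegative
  off-diagonal entries, the couplings of the edges, and its rows sum to zero because angles are
  invariant under scaling. Hence the
  curvature tested against a direction \<open>w\<close> grows along \<open>w\<close> at the rate of a Dirichlet form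
  \<open>\<Sum> c\<^sub>i\<^sub>j (w\<^sub>i - w\<^sub>j)\<^sup>2\<close>. The coupling of an edge may vanish, but of at most one edge per face
  (\<open>coupling_eq_0D\<close>), so on a connected surface the form vanishes only on constant directions. A
  compactness argument gives \<open>\<langle>K(u) - K(v), u - v\<rangle> \<ge> c |u - v|\<^sup>2\<close> on bounded parts of the
  hyperplane \<open>\<Sum> u\<^sub>i = 0\<close> (\<open>curvature_strongly_monotone\<close>).

  The other term \<open>s\<^sub>\<alpha> r\<^sub>i\<^sup>\<alpha>\<close> is \<open>2\<pi>\<chi>\<close> times the softmax of \<open>\<alpha> u\<close>. Softmax is monotone, and
  \<open>\<alpha>\<chi> \<le> 0\<close> turns this into the favourable sign (\<open>area_term_antitone\<close>).

  Invariance of domain shows that every edge of a triangulated closed surface lies in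
  exactly two faces (\<open>card_faces_at_edge\<close>). Hence \<open>2 |E| = 3 |F|\<close>, and as the angles of a triangle
  sum to \<open>\<pi>\<close> the total curvature is \<open>2\<pi>\<chi>\<close> (\<open>gauss_bonnet\<close>). So \<open>V\<close> has sum zero, the flow stays on
  the hyperplane, and the metrics of constant \<open>\<alpha>\<close>-curvature are exactly the zeros of \<open>V\<close>.

  If the flow converges, then \<open>V\<close> vanishes at the limit. If \<open>V(u\<^sub>0) = 0\<close>, then, after
  rescaling the metric \<open>exp u\<^sub>0\<close> into the hyperplane, \<open>|u(t) - u\<^sub>0|\<^sup>2\<close> decays exponentially (\<open>flow_contracts_to_stationary\<close>).
\<close>

section \<open>The angles of a circle packing triangle\<close>

text \<open>
  The angle is differentiated as a function of the squared sides, because for circle packings these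
  are polynomials in the radii. The square root in the denominator is four times the area of the
  triangle.
\<close>

lemma triangle_angle_sqrt_has_derivative:
  fixes p q s :: "real \<Rightarrow> real"
  assumes "(p has_real_derivative p') (at t)" "(q has_real_derivative q') (at t)"
    and "(s has_real_derivative s') (at t)"
    and "0 < q t" "0 < s t" "\<And>\<tau>. 0 \<le> p \<tau>" "\<And>\<tau>. 0 \<le> q \<tau>" "\<And>\<tau>. 0 \<le> s \<tau>"
    and area: "(q t + s t - p t)\<^sup>2 < 4 * q t * s t"
  shows "((\<lambda>\<tau>. triangle_angle (sqrt (s \<tau>)) (sqrt (q \<tau>)) (sqrt (p \<tau>))) has_real_derivative
     (p' - (p t + q t - s t) * q' / (2 * q t) - (p t + s t - q t) * s' / (2 * s t)) /
       sqrt (4 * q t * s t - (q t + s t - p t)\<^sup>2)) (at t)"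
proof -
  define m where "m = q t + s t - p t"
  define R where "R = sqrt (s t) * sqrt (q t)"
  define S where "S = sqrt (4 * q t * s t - m\<^sup>2)"
  have R: "0 < R" "R\<^sup>2 = q t * s t"
    using assms by (auto simp: R_def power_mult_distrib)
  have S: "0 < S" "S\<^sup>2 = 4 * q t * s t - m\<^sup>2"
    using area by (auto simp: S_def m_def)
  have "(m / (2 * R))\<^sup>2 < 1"
    using area R assms(4,5) by (simp add: power_divide power_mult_distrib m_def)
  then have "\<bar>m / (2 * R)\<bar> < 1"
    by (rule abs_square_less_1[THEN iffD1])
  then have bnd: "-1 < m / (2 * R)" "m / (2 * R) < 1"
    by linarith+
  have root: "sqrt (1 - (m / (2 * R))\<^sup>2) = S / (2 * R)"
  proof (rule real_sqrt_unique)
    show "(S / (2 * R))\<^sup>2 = 1 - (m / (2 * R))\<^sup>2"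
      using R S assms(4,5) by (simp add: power_divide power_mult_distrib field_simps)
  qed (use R S in simp)
  have root_deriv: "((\<lambda>\<tau>. sqrt (f \<tau>)) has_real_derivative sqrt (f t) * (f' / (2 * f t))) (at t)"
    if "(f has_real_derivative f') (at t)" "0 < f t" for f f'
  proof -
    have eq: "inverse (sqrt (f t)) / 2 * f' = sqrt (f t) * (f' / (2 * f t))"
      using that(2) by (simp add: field_simps flip: power2_eq_square)
    show ?thesis
      using DERIV_chain2[OF DERIV_real_sqrt[OF that(2)] that(1)] unfolding eq .
  qed
  have "((\<lambda>\<tau>. (q \<tau> + s \<tau> - p \<tau>) / (2 * sqrt (s \<tau>) * sqrt (q \<tau>))) has_real_derivative
      (q' + s' - p') / (2 * R) - m * (q' / q t + s' / s t) / (4 * R)) (at t)"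
    by (rule derivative_eq_intros root_deriv assms refl)+
      (use assms(4,5) in \<open>simp_all add: R_def m_def field_simps\<close>)
  note quotient = this
  have val: "(q t + s t - p t) / (2 * sqrt (s t) * sqrt (q t)) = m / (2 * R)"
    by (simp add: m_def R_def)
  have "((\<lambda>\<tau>. arccos ((q \<tau> + s \<tau> - p \<tau>) / (2 * sqrt (s \<tau>) * sqrt (q \<tau>)))) has_real_derivative
      inverse (- sqrt (1 - (m / (2 * R))\<^sup>2)) *
      ((q' + s' - p') / (2 * R) - m * (q' / q t + s' / s t) / (4 * R))) (at t)"
    by (rule DERIV_chain2[OF _ quotient], unfold val, rule DERIV_arccos[OF bnd])
  also have "inverse (- sqrt (1 - (m / (2 * R))\<^sup>2)) *
      ((q' + s' - p') / (2 * R) - m * (q' / q t + s' / s t) / (4 * R)) =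
      (p' - (p t + q t - s t) * q' / (2 * q t) - (p t + s t - q t) * s' / (2 * s t)) / S"
    unfolding root unfolding m_def using R(1) S(1) assms(4,5) by (simp add: divide_simps) algebra
  finally show ?thesis
    using assms by (simp add: triangle_angle_def add_ac S_def m_def)
qed

definition sqlen :: "real \<Rightarrow> real \<Rightarrow> real \<Rightarrow> real" where
  "sqlen x y c = x\<^sup>2 + y\<^sup>2 + 2 * x * y * c"

text \<open>
  For side lengths coming from circles of radii \<open>x\<close>, \<open>y\<close>, \<open>z\<close> this is four times the squared area
  (Heron's formula, see \<open>heron_eq\<close>). Throughout, \<open>a\<close>, \<open>b\<close>, \<open>c\<close> are the cosines of the weights
  of the edges opposite to the vertices with radii \<open>x\<close>, \<open>y\<close>, \<open>z\<close>. In the expanded form every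
  summand is visibly nonnegative for cosines in \<open>[0, 1]\<close>, so the triangle inequality is read off.
\<close>

definition heron :: "real \<Rightarrow> real \<Rightarrow> real \<Rightarrow> real \<Rightarrow> real \<Rightarrow> real \<Rightarrow> real" where
  "heron x y z a b c = x\<^sup>2 * y\<^sup>2 * (1 - c\<^sup>2) + y\<^sup>2 * z\<^sup>2 * (1 - a\<^sup>2) + x\<^sup>2 * z\<^sup>2 * (1 - b\<^sup>2)
     + 2 * x * y * z * (x * (a + b * c) + y * (b + a * c) + z * (c + a * b))"

lemma heron_eq:
  "4 * sqlen x z b * sqlen x y c - (sqlen x z b + sqlen x y c - sqlen y z a)\<^sup>2 = 4 * heron x y z a b c"
  unfolding sqlen_def heron_def by algebra

definition cp_angle :: "real \<Rightarrow> real \<Rightarrow> real \<Rightarrow> real \<Rightarrow> real \<Rightarrow> real \<Rightarrow> real" where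
  "cp_angle x y z a b c =
     triangle_angle (sqrt (sqlen x y c)) (sqrt (sqlen x z b)) (sqrt (sqlen y z a))"

text \<open>
  The derivative of the angle at the first vertex with respect to \<open>ln y\<close>; as the formula is
  symmetric in the two ends of the edge, the Jacobian of the angles is symmetric.
\<close>

definition coupling :: "real \<Rightarrow> real \<Rightarrow> real \<Rightarrow> real \<Rightarrow> real \<Rightarrow> real \<Rightarrow> real" where
  "coupling x y z a b c =
     x * y * (x * y * (1 - c\<^sup>2) + z * a * (x + y * c) + z * b * (y + x * c)) /
     (sqlen x y c * sqrt (heron x y z a b c))"

lemma sqlen_pos: "0 < x \<Longrightarrow> 0 < y \<Longrightarrow> 0 \<le> c \<Longrightarrow> 0 < sqlen x y c"
  unfolding sqlen_def by (intro add_pos_nonneg) auto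

lemma heron_pos:
  assumes "0 < x" "0 < y" "0 < z" and "a \<in> {0..1}" "b \<in> {0..1}" "c \<in> {0..1}"
  shows "0 < heron x y z a b c"
proof -
  have sq: "0 \<le> 1 - a\<^sup>2" "0 \<le> 1 - b\<^sup>2" "0 \<le> 1 - c\<^sup>2"
    using assms by (simp_all add: power_le_one)
  have parts: "0 \<le> x\<^sup>2 * y\<^sup>2 * (1 - c\<^sup>2)" "0 \<le> y\<^sup>2 * z\<^sup>2 * (1 - a\<^sup>2)" "0 \<le> x\<^sup>2 * z\<^sup>2 * (1 - b\<^sup>2)"
    using sq by simp_all
  have parts2: "0 \<le> x * (a + b * c)" "0 \<le> y * (b + a * c)" "0 \<le> z * (c + a * b)"
    using assms by simp_all
  show ?thesis
  proof (cases "c = 1")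
    case True
    then have "0 < z * (c + a * b)"
      using assms by (simp add: add_pos_nonneg)
    then have "0 < x * (a + b * c) + y * (b + a * c) + z * (c + a * b)"
      using parts2 by linarith
    then have "0 < 2 * x * y * z * (x * (a + b * c) + y * (b + a * c) + z * (c + a * b))"
      using assms by simp
    then show ?thesis
      unfolding heron_def using parts by linarith
  next
    case False
    then have "c\<^sup>2 < 1"
      using assms by (simp add: abs_square_less_1)
    then have "0 < x\<^sup>2 * y\<^sup>2 * (1 - c\<^sup>2)"
      using assms by simp
    moreover have "0 \<le> 2 * x * y * z * (x * (a + b * c) + y * (b + a * c) + z * (c + a * b))"
      using parts2 assms by (intro mult_nonneg_nonneg add_nonneg_nonneg) auto
    ultimately show ?thesis
      unfolding heron_def using parts by linarith
  qed
qed

lemma coupling_commute: "coupling x y z a b c = coupling y x z b a c"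
  unfolding coupling_def heron_def sqlen_def by (simp add: algebra_simps)

lemma coupling_nonneg:
  assumes "0 < x" "0 < y" "0 < z" and "a \<in> {0..1}" "b \<in> {0..1}" "c \<in> {0..1}"
  shows "0 \<le> coupling x y z a b c"
proof -
  have "0 \<le> 1 - c\<^sup>2"
    using assms by (simp add: power_le_one)
  then show ?thesis
    unfolding coupling_def using sqlen_pos[of x y c] heron_pos[OF assms] assms by simp
qed

text \<open>
  The numerator is a sum of nonnegative terms, so an edge can decouple only if its two circles are
  tangent and both are orthogonal to the third circle. This does happen, but for at most one edge
  of a face.
\<close>

lemma coupling_eq_0D:
  assumes "coupling x y z a b c = 0"
    and "0 < x" "0 < y" "0 < z" and "a \<in> {0..1}" "b \<in> {0..1}" "c \<in> {0..1}"
  shows "a = 0" "b = 0" "c = 1"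
proof -
  have "0 < sqlen x y c * sqrt (heron x y z a b c)"
    using sqlen_pos[of x y c] heron_pos[OF assms(2-7)] assms(2-7) by simp
  then have sum: "x * y * (1 - c\<^sup>2) + z * a * (x + y * c) + z * b * (y + x * c) = 0"
    using assms unfolding coupling_def by auto
  have c2: "0 \<le> 1 - c\<^sup>2"
    using assms by (simp add: power_le_one)
  have nn: "0 \<le> x * y * (1 - c\<^sup>2)" "0 \<le> z * a * (x + y * c)" "0 \<le> z * b * (y + x * c)"
    using c2 assms by simp_all
  then have z: "x * y * (1 - c\<^sup>2) = 0" "z * a * (x + y * c) = 0" "z * b * (y + x * c) = 0"
    using sum by linarith+
  have "0 < x + y * c" "0 < y + x * c"
    using assms by (simp_all add: add_pos_nonneg)
  then show "a = 0" "b = 0"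
    using z assms by simp_all
  show "c = 1"
    using z(1) assms by (auto simp: power2_eq_1_iff)
qed

text \<open>
  Only the differences of the logarithmic velocities \<open>wx\<close>, \<open>wy\<close>, \<open>wz\<close> enter, because the angle
  is invariant under scaling.
\<close>

lemma cp_angle_has_derivative:
  fixes X Y Z :: "real \<Rightarrow> real"
  assumes "(X has_real_derivative X t * wx) (at t)" "(Y has_real_derivative Y t * wy) (at t)"
    and "(Z has_real_derivative Z t * wz) (at t)"
    and pos: "\<And>\<tau>. 0 < X \<tau>" "\<And>\<tau>. 0 < Y \<tau>" "\<And>\<tau>. 0 < Z \<tau>"
    and cos: "a \<in> {0..1}" "b \<in> {0..1}" "c \<in> {0..1}"
  shows "((\<lambda>\<tau>. cp_angle (X \<tau>) (Y \<tau>) (Z \<tau>) a b c) has_real_derivative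
     coupling (X t) (Y t) (Z t) a b c * (wy - wx) + coupling (X t) (Z t) (Y t) a c b * (wz - wx)) (at t)"
proof -
  define x y z where xyz: "x = X t" "y = Y t" "z = Z t"
  define p q s where pqs: "p = sqlen y z a" "q = sqlen x z b" "s = sqlen x y c"
  define dl where "dl x y c v w = 2 * x\<^sup>2 * v + 2 * y\<^sup>2 * w + 2 * x * y * c * (v + w)" for x y c v w :: real
  have deriv: "((\<lambda>\<tau>. sqlen (A \<tau>) (B \<tau>) k) has_real_derivative dl (A t) (B t) k v w) (at t)"
    if "(A has_real_derivative A t * v) (at t)" "(B has_real_derivative B t * w) (at t)" for A B k v w
    unfolding sqlen_def dl_def
    by (rule derivative_eq_intros that refl)+ (simp add: algebra_simps power2_eq_square)
  have posl: "0 < p" "0 < q" "0 < s"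
    unfolding pqs xyz using pos cos by (auto intro!: sqlen_pos)
  have h: "0 < heron x y z a b c"
    unfolding xyz using pos cos by (intro heron_pos) auto
  have S: "sqrt (4 * q * s - (q + s - p)\<^sup>2) = 2 * sqrt (heron x y z a b c)"
    using heron_eq[of x z b y c a] unfolding pqs by (simp add: real_sqrt_mult)
  have "((\<lambda>\<tau>. cp_angle (X \<tau>) (Y \<tau>) (Z \<tau>) a b c) has_real_derivative
     (dl y z a wy wz - (p + q - s) * dl x z b wx wz / (2 * q) - (p + s - q) * dl x y c wx wy / (2 * s)) /
       sqrt (4 * q * s - (q + s - p)\<^sup>2)) (at t)"
    unfolding cp_angle_def pqs xyz
    by (rule triangle_angle_sqrt_has_derivative)
      (use pos cos h heron_eq[of x z b y c a] in
        \<open>auto intro!: deriv assms less_imp_le[OF sqlen_pos] sqlen_pos simp: xyz\<close>)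
  also have "(dl y z a wy wz - (p + q - s) * dl x z b wx wz / (2 * q) - (p + s - q) * dl x y c wx wy / (2 * s)) /
       sqrt (4 * q * s - (q + s - p)\<^sup>2) =
     coupling x y z a b c * (wy - wx) + coupling x z y a c b * (wz - wx)"
  proof -
    have clear: "D - P * d / (2 * l) = 2 * h * (n / (l * h))"
      if "2 * l * D - P * d = 4 * n" "0 < l" "0 < h" for D P d l h n :: real
      using that by (simp add: field_simps)
    have cxy: "dl y z a 1 0 - (p + s - q) * dl x y c 0 1 / (2 * s) =
      2 * sqrt (heron x y z a b c) * coupling x y z a b c"
    proof -
      have "2 * s * dl y z a 1 0 - (p + s - q) * dl x y c 0 1 =
        4 * (x * y * (x * y * (1 - c\<^sup>2) + z * a * (x + y * c) + z * b * (y + x * c)))"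
        unfolding pqs sqlen_def dl_def by algebra
      then show ?thesis
        unfolding coupling_def pqs(3)[symmetric] using posl h by (intro clear) auto
    qed
    have cxz: "dl y z a 0 1 - (p + q - s) * dl x z b 0 1 / (2 * q) =
      2 * sqrt (heron x y z a b c) * coupling x z y a c b"
    proof -
      have "2 * q * dl y z a 0 1 - (p + q - s) * dl x z b 0 1 =
        4 * (x * z * (x * z * (1 - b\<^sup>2) + y * a * (x + z * b) + y * c * (z + x * b)))"
        unfolding pqs sqlen_def dl_def by algebra
      moreover have hc: "heron x z y a c b = heron x y z a b c"
        unfolding heron_def by algebra
      ultimately show ?thesis
        unfolding coupling_def pqs(2)[symmetric] hc using posl h by (intro clear) auto
    qed
    \<comment> \<open>Scaling by \<open>wx\<close> is split off; by homogeneity it multiplies the squared sides by \<open>2 wx\<close>.\<close>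
    have "dl y z a wy wz = 2 * p * wx + dl y z a 1 0 * (wy - wx) + dl y z a 0 1 * (wz - wx)"
      "dl x z b wx wz = 2 * q * wx + dl x z b 0 1 * (wz - wx)"
      "dl x y c wx wy = 2 * s * wx + dl x y c 0 1 * (wy - wx)"
      unfolding pqs sqlen_def dl_def by algebra+
    note expand = this
    have "dl y z a wy wz - (p + q - s) * dl x z b wx wz / (2 * q) - (p + s - q) * dl x y c wx wy / (2 * s)
      = (dl y z a 1 0 - (p + s - q) * dl x y c 0 1 / (2 * s)) * (wy - wx)
      + (dl y z a 0 1 - (p + q - s) * dl x z b 0 1 / (2 * q)) * (wz - wx)"
    proof -
      have "(p + q - s) * (2 * q * wx + dl x z b 0 1 * (wz - wx)) / (2 * q) =
          (p + q - s) * wx + (p + q - s) * dl x z b 0 1 / (2 * q) * (wz - wx)"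
        "(p + s - q) * (2 * s * wx + dl x y c 0 1 * (wy - wx)) / (2 * s) =
          (p + s - q) * wx + (p + s - q) * dl x y c 0 1 / (2 * s) * (wy - wx)"
        using posl by (simp_all add: field_simps)
      then show ?thesis
        unfolding expand by (simp add: algebra_simps)
    qed
    then show ?thesis
      unfolding cxy cxz S using h by (simp add: add_divide_distrib)
  qed
  finally show ?thesis
    unfolding xyz .
qed

text \<open>
  All three sines share the factor \<open>T\<close>, four times the area. The addition theorems show that the sum
  of two of the angles has a positive sine, hence is below \<open>\<pi>\<close>, and that its cosine is minus the
  cosine of the third angle.
\<close>

lemma triangle_angle_sum:
  assumes pos: "0 < a" "0 < b" "0 < c" and area: "(b\<^sup>2 + c\<^sup>2 - a\<^sup>2)\<^sup>2 < 4 * b\<^sup>2 * c\<^sup>2"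
  shows "triangle_angle b c a + triangle_angle a c b + triangle_angle a b c = pi"
proof -
  define T where "T = sqrt (4 * b\<^sup>2 * c\<^sup>2 - (b\<^sup>2 + c\<^sup>2 - a\<^sup>2)\<^sup>2)"
  have T: "0 < T" "T\<^sup>2 = 4 * b\<^sup>2 * c\<^sup>2 - (b\<^sup>2 + c\<^sup>2 - a\<^sup>2)\<^sup>2"
    using area by (auto simp: T_def)
  have trig: "cos (triangle_angle x y z) = (x\<^sup>2 + y\<^sup>2 - z\<^sup>2) / (2 * x * y)"
     "sin (triangle_angle x y z) = T / (2 * x * y)"
     "0 \<le> triangle_angle x y z" "triangle_angle x y z \<le> pi"
    if "0 < x" "0 < y" "T\<^sup>2 = 4 * x\<^sup>2 * y\<^sup>2 - (x\<^sup>2 + y\<^sup>2 - z\<^sup>2)\<^sup>2" for x y z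
  proof -
    define m where "m = (x\<^sup>2 + y\<^sup>2 - z\<^sup>2) / (2 * x * y)"
    have sq: "1 - m\<^sup>2 = (T / (2 * x * y))\<^sup>2"
      using that by (simp add: m_def field_simps)
    then have "m\<^sup>2 \<le> 1"
      by (metis diff_ge_0_iff_ge zero_le_power2)
    then have "\<bar>m\<bar> \<le> 1"
      by (simp add: abs_square_le_1)
    then have m: "-1 \<le> m" "m \<le> 1"
      by linarith+
    then show "cos (triangle_angle x y z) = (x\<^sup>2 + y\<^sup>2 - z\<^sup>2) / (2 * x * y)"
       "0 \<le> triangle_angle x y z" "triangle_angle x y z \<le> pi"
      unfolding triangle_angle_def m_def[symmetric] by (auto intro: arccos_lbound arccos_ubound)
    show "sin (triangle_angle x y z) = T / (2 * x * y)"
      unfolding triangle_angle_def m_def[symmetric] sin_arccos[OF m] sq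
      using that T(1) by simp
  qed
  let ?A = "triangle_angle b c a" and ?B = "triangle_angle a c b" and ?C = "triangle_angle a b c"
  note A = trig[OF pos(2,3), of a] and B = trig[OF pos(1,3), of b] and C = trig[OF pos(1,2), of c]
  have T': "T\<^sup>2 = 4 * a\<^sup>2 * c\<^sup>2 - (a\<^sup>2 + c\<^sup>2 - b\<^sup>2)\<^sup>2" "T\<^sup>2 = 4 * a\<^sup>2 * b\<^sup>2 - (a\<^sup>2 + b\<^sup>2 - c\<^sup>2)\<^sup>2"
    unfolding T(2) by algebra+
  have "sin (?A + ?B) = T / (2 * a * b)"
    unfolding sin_add A(1,2)[OF T(2)] B(1,2)[OF T'(1)] using pos
    by (simp add: divide_simps) algebra
  then have sin: "0 < sin (?A + ?B)"
    using T pos by simp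
  have "?A + ?B < pi"
  proof (rule ccontr)
    assume "\<not> ?A + ?B < pi"
    then have "0 \<le> sin (?A + ?B - pi)"
      using A(4)[OF T(2)] B(4)[OF T'(1)] by (intro sin_ge_zero) auto
    then show False
      using sin by (simp add: sin_diff)
  qed
  have "cos (?A + ?B) = (((b\<^sup>2 + c\<^sup>2 - a\<^sup>2) * (a\<^sup>2 + c\<^sup>2 - b\<^sup>2)) - T\<^sup>2) / (4 * a * b * c\<^sup>2)"
    unfolding cos_add A(1,2)[OF T(2)] B(1,2)[OF T'(1)] using pos
    by (simp add: field_simps power2_eq_square)
  also have "\<dots> = - ((a\<^sup>2 + b\<^sup>2 - c\<^sup>2) / (2 * a * b))"
    unfolding T(2) using pos by (simp add: divide_simps) algebra
  finally have "cos (pi - (?A + ?B)) = (a\<^sup>2 + b\<^sup>2 - c\<^sup>2) / (2 * a * b)"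
    by (simp add: cos_diff minus_divide_left)
  then have "?C = arccos (cos (pi - (?A + ?B)))"
    by (simp add: triangle_angle_def)
  also have "\<dots> = pi - (?A + ?B)"
    using \<open>?A + ?B < pi\<close> A(3)[OF T(2)] B(3)[OF T'(1)] by (intro arccos_cos) auto
  finally show ?thesis
    by simp
qed

lemma cp_angle_sum:
  assumes "0 < x" "0 < y" "0 < z" and "a \<in> {0..1}" "b \<in> {0..1}" "c \<in> {0..1}"
  shows "cp_angle x y z a b c + cp_angle y x z b a c + cp_angle z x y c a b = pi"
proof -
  have sym: "sqlen v w k = sqlen w v k" for v w k
    by (simp add: sqlen_def)
  have "0 < sqlen x y c" "0 < sqlen x z b" "0 < sqlen y z a"
    using assms by (auto intro: sqlen_pos)
  moreover have "(sqlen x z b + sqlen x y c - sqlen y z a)\<^sup>2 < 4 * sqlen x z b * sqlen x y c"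
    using heron_eq[of x z b y c a] heron_pos[OF assms] by simp
  ultimately have "triangle_angle (sqrt (sqlen x z b)) (sqrt (sqlen x y c)) (sqrt (sqlen y z a))
    + triangle_angle (sqrt (sqlen y z a)) (sqrt (sqlen x y c)) (sqrt (sqlen x z b))
    + triangle_angle (sqrt (sqlen y z a)) (sqrt (sqlen x z b)) (sqrt (sqlen x y c)) = pi"
    by (intro triangle_angle_sum) auto
  then show ?thesis
    by (simp add: cp_angle_def triangle_angle_def sym[of y x] sym[of z x] sym[of z y] add_ac mult_ac)
qed

lemma cp_angle_tendsto:
  assumes "(X \<longlongrightarrow> x) G" "(Y \<longlongrightarrow> y) G" "(Z \<longlongrightarrow> z) G"
    and "0 < x" "0 < y" "0 < z" and "a \<in> {0..1}" "b \<in> {0..1}" "c \<in> {0..1}"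
  shows "((\<lambda>t. cp_angle (X t) (Y t) (Z t) a b c) \<longlongrightarrow> cp_angle x y z a b c) G"
proof -
  have pos: "0 < sqlen x y c" "0 < sqlen x z b" "0 < sqlen y z a"
    using assms by (auto intro: sqlen_pos)
  define m where "m = (sqlen x y c + sqlen x z b - sqlen y z a) / (2 * sqrt (sqlen x y c) * sqrt (sqlen x z b))"
  have "m\<^sup>2 < 1"
    using heron_eq[of x z b y c a] heron_pos[OF assms(4-9)] pos
    by (simp add: m_def power_divide power_mult_distrib add_ac mult_ac)
  then have "\<bar>m\<bar> < 1"
    by (simp add: abs_square_less_1)
  then have "isCont arccos m"
    by (intro isCont_arccos) auto
  moreover have "((\<lambda>t. ((sqrt (sqlen (X t) (Y t) c))\<^sup>2 + (sqrt (sqlen (X t) (Z t) b))\<^sup>2 - (sqrt (sqlen (Y t) (Z t) a))\<^sup>2) /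
     (2 * sqrt (sqlen (X t) (Y t) c) * sqrt (sqlen (X t) (Z t) b))) \<longlongrightarrow>
     ((sqrt (sqlen x y c))\<^sup>2 + (sqrt (sqlen x z b))\<^sup>2 - (sqrt (sqlen y z a))\<^sup>2) /
     (2 * sqrt (sqlen x y c) * sqrt (sqlen x z b))) G"
    using pos unfolding sqlen_def by (intro tendsto_intros assms) auto
  moreover have m: "((sqrt (sqlen x y c))\<^sup>2 + (sqrt (sqlen x z b))\<^sup>2 - (sqrt (sqlen y z a))\<^sup>2) /
     (2 * sqrt (sqlen x y c) * sqrt (sqlen x z b)) = m"
    using pos by (simp add: m_def)
  ultimately show ?thesis
    unfolding cp_angle_def triangle_angle_def m by (intro isCont_tendsto_compose[of m arccos])
qed

section \<open>Edges and faces of a triangulated surface\<close>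

lemma realization_chart:
  fixes E F :: "'v::finite set set"
  assumes "closed_surface (M :: 'm topology)" "triangulates E F M" "x \<in> geometric_realization E F"
  obtains N W h k where "openin (top_of_set (geometric_realization E F)) N" "x \<in> N"
    "open (W :: (real ^ 2) set)" "homeomorphism N W h k"
proof -
  let ?X = "geometric_realization E F"
  obtain f g where fg: "homeomorphic_maps (top_of_set ?X) M f g"
    using assms(2) unfolding triangulates_def homeomorphic_space_def by blast
  then have f: "homeomorphic_map (top_of_set ?X) M f"
    by (rule homeomorphic_maps_map[THEN iffD1, THEN conjunct1])
  have "f x \<in> topspace M"
    using homeomorphic_imp_surjective_map[OF f] assms(3) by auto
  then obtain U W where UW: "openin M U" "f x \<in> U" "open (W :: (real ^ 2) set)"
      "subtopology M U homeomorphic_space top_of_set W"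
    using assms(1) unfolding closed_surface_def by blast
  define N where "N = {y \<in> ?X. f y \<in> U}"
  have N: "openin (top_of_set ?X) N"
    using openin_continuous_map_preimage[OF homeomorphic_imp_continuous_map[OF f] UW(1)]
    by (simp add: N_def)
  have "homeomorphic_map (subtopology (top_of_set ?X) N) (subtopology M U) f"
    by (rule homeomorphic_map_subtopologies_alt[OF f]) (auto simp: N_def)
  moreover have "subtopology (top_of_set ?X) N = top_of_set N"
    by (simp add: subtopology_subtopology N_def Int_absorb1 Collect_restrict)
  ultimately have "top_of_set N homeomorphic_space subtopology M U"
    by (metis homeomorphic_map_imp_homeomorphic_space)
  then have "top_of_set N homeomorphic_space top_of_set W"
    using UW(4) homeomorphic_space_trans by blast
  then obtain h k where "homeomorphic_maps (top_of_set N) (top_of_set W) h k"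
    by (auto simp: homeomorphic_space_def)
  then have "homeomorphism N W h k"
    unfolding homeomorphic_maps_def homeomorphism_def
    by (auto simp: Pi_iff image_iff) metis+
  then show ?thesis
    using that[OF N _ UW(3)] assms(3) UW(2) by (auto simp: N_def)
qed

text \<open>
  Invariance of domain, transported through a chart: an injective continuous map from an open part of
  the surface to the plane is open.
\<close>

lemma planar_image_open:
  assumes "openin (top_of_set X) N" "open (W :: (real ^ 2) set)" "homeomorphism N W h k"
    and "openin (top_of_set X) U" "continuous_on U g" "inj_on g U"
  shows "open ((g :: _ \<Rightarrow> real \<times> real) ` (U \<inter> N))"
proof -
  have "openin (top_of_set N) (U \<inter> N)"
    using assms(1,4) by (metis inf_commute openin_Int openin_imp_subset openin_subset_trans inf_le1)
  then have "openin (top_of_set W) (h ` (U \<inter> N))"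
    using assms(3) homeomorphism_imp_open_map by blast
  then have op: "open (h ` (U \<inter> N))"
    using assms(2) openin_open_trans by blast
  have kh: "k (h y) = y" if "y \<in> U \<inter> N" for y
    using assms(3) that by (auto simp: homeomorphism_def)
  have "continuous_on (h ` (U \<inter> N)) (g \<circ> k)"
  proof (rule continuous_on_compose)
    show "continuous_on (h ` (U \<inter> N)) k"
      using assms(3) by (auto simp: homeomorphism_def elim: continuous_on_subset)
    show "continuous_on (k ` h ` (U \<inter> N)) g"
      using assms(5) kh by (auto elim!: continuous_on_subset)
  qed
  moreover have "inj_on (g \<circ> k) (h ` (U \<inter> N))"
    using assms(6) kh by (auto simp: inj_on_def)
  ultimately have "open ((g \<circ> k) ` h ` (U \<inter> N))"
    by (intro invariance_of_domain_gen[OF op]) auto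
  moreover have "(g \<circ> k) ` h ` (U \<inter> N) = g ` (U \<inter> N)"
    using kh by (force simp: image_iff)
  ultimately show ?thesis
    by simp
qed

text \<open>
  Invariance of domain again, now for planar patches embedded in the surface.
\<close>

lemma planar_patch_open:
  assumes "openin (top_of_set X) N" "open (W :: (real ^ 2) set)" "homeomorphism N W h k"
    and "open (B :: (real \<times> real) set)" "continuous_on B \<psi>" "inj_on \<psi> B" "\<psi> ` B \<subseteq> X"
  shows "openin (top_of_set X) (\<psi> ` B \<inter> N)"
proof -
  define B' where "B' = B \<inter> \<psi> -` N"
  obtain O' where O': "open O'" "N = X \<inter> O'"
    using assms(1) by (auto simp: openin_open)
  have "B' = B \<inter> \<psi> -` O'"
    using O' assms(7) by (auto simp: B'_def)
  then have op: "open B'"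
    using continuous_open_preimage[OF assms(5,4) O'(1)] by simp
  have "continuous_on B' (h \<circ> \<psi>)"
    using assms(3,5) by (intro continuous_on_compose)
      (auto simp: homeomorphism_def B'_def elim!: continuous_on_subset)
  moreover have "inj_on (h \<circ> \<psi>) B'"
  proof (rule comp_inj_on)
    show "inj_on \<psi> B'"
      using assms(6) by (auto simp: B'_def inj_on_def)
    show "inj_on h (\<psi> ` B')"
      using assms(3) by (intro inj_on_inverseI[where g = k]) (auto simp: homeomorphism_def B'_def)
  qed
  ultimately have "open ((h \<circ> \<psi>) ` B')"
    by (intro invariance_of_domain_gen[OF op]) auto
  moreover have "(h \<circ> \<psi>) ` B' \<subseteq> W"
    using assms(3) by (auto simp: homeomorphism_def B'_def)
  ultimately have "openin (top_of_set W) ((h \<circ> \<psi>) ` B')"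
    using assms(2) by (simp add: openin_open_eq)
  then have "openin (top_of_set N) (k ` (h \<circ> \<psi>) ` B')"
    using homeomorphism_imp_open_map[OF homeomorphism_symD[OF assms(3)]] by blast
  moreover have "k ` (h \<circ> \<psi>) ` B' = \<psi> ` B \<inter> N"
    using assms(3) by (force simp: homeomorphism_def B'_def image_iff)
  ultimately show ?thesis
    using openin_trans assms(1) by metis
qed


definition edge_midpoint :: "'v::finite \<Rightarrow> 'v \<Rightarrow> real ^ 'v" where
  "edge_midpoint a b = (\<chi> i. if i = a \<or> i = b then 1/2 else 0)"

lemma edge_midpoint_in_realization:
  assumes "{a, b} \<in> E" "a \<noteq> b"
  shows "edge_midpoint a b \<in> geometric_realization E F"
proof -
  have "{i. i = a \<or> i = b} = {a, b}"
    by auto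
  moreover have "(\<Sum>i\<in>UNIV. if i = a \<or> i = b then 1/2 else 0 :: real) = 1"
    using sum.mono_neutral_cong_right[of UNIV "{a,b}" "\<lambda>i. if i = a \<or> i = b then 1/2 else 0 :: real" "\<lambda>_. 1/2"] assms by auto
  ultimately show ?thesis
    using assms by (auto simp: geometric_realization_def edge_midpoint_def)
qed

text \<open>
  The open star of the edge \<open>{a, b}\<close> consists of the open edge and of the faces that contain it;
  these are the pages of a book whose spine is the edge.
\<close>

lemma edge_star_coordinates:
  assumes "simplicial_2_complex E F" "a \<noteq> b" "x \<in> geometric_realization E F" "0 < x $ a" "0 < x $ b"
  obtains "{i. x $ i \<noteq> 0} = {a, b}" "x $ a + x $ b = 1"
  | k where "k \<noteq> a" "k \<noteq> b" "{a, b, k} \<in> F" "{i. x $ i \<noteq> 0} = {a, b, k}" "x $ a + x $ b + x $ k = 1" "0 < x $ k"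
proof -
  have x: "\<And>i. 0 \<le> x $ i" "(\<Sum>i\<in>UNIV. x $ i) = 1" "{i. x $ i \<noteq> 0} \<in> range (\<lambda>i. {i}) \<union> E \<union> F"
    using assms(3) by (auto simp: geometric_realization_def)
  have card: "\<And>e. e \<in> E \<Longrightarrow> card e = 2" "\<And>f. f \<in> F \<Longrightarrow> card f = 3"
    using assms(1) by (auto simp: simplicial_2_complex_def)
  let ?S = "{i. x $ i \<noteq> 0}"
  have sub: "{a, b} \<subseteq> ?S"
    using assms by auto
  have sum: "(\<Sum>i\<in>?S. x $ i) = 1"
    unfolding x(2)[symmetric] by (rule sum.mono_neutral_left) auto
  consider j where "?S = {j}" | "?S \<in> E" | "?S \<in> F"
    using x(3) by auto
  then show ?thesis
  proof cases
    case 1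
    then show ?thesis
      using sub assms(2) by auto
  next
    case 2
    then have "?S = {a, b}"
      using card(1)[OF 2] sub assms(2) by (metis card_2_iff card_subset_eq finite)
    then show ?thesis
      using that(1) sum assms(2) by auto
  next
    case 3
    have "card (?S - {a, b}) = 1"
      using card(2)[OF 3] sub assms(2) by (simp add: card_Diff_subset)
    then obtain k where k: "?S - {a, b} = {k}"
      by (auto simp: card_1_singleton_iff)
    then have S: "?S = {a, b, k}" "k \<noteq> a" "k \<noteq> b"
      using sub by auto
    have "x $ k \<noteq> 0"
      using S(1) by blast
    then show ?thesis
      using that(2)[of k] S sum assms(2) 3 x(1)[of k] by (auto simp: less_le add_ac)
  qed
qed

lemma edge_star_open:
  "openin (top_of_set (geometric_realization E F)) {x \<in> geometric_realization E F. 0 < x $ a \<and> 0 < x $ b}"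
proof -
  have "open {x :: real ^ 'a. 0 < x $ a \<and> 0 < x $ b}"
    by (intro open_Collect_conj open_Collect_less continuous_intros)
  then show ?thesis
    by (auto simp: openin_open)
qed

text \<open>
  With at most one page the star of the edge embeds into a closed half-plane with the midpoint of the
  edge on the boundary line, and the image of the star could not be open.
\<close>

lemma two_pages_at_edge:
  fixes E F :: "'v::finite set set"
  assumes M: "closed_surface (M :: 'm topology)" "triangulates E F M" and e: "{a, b} \<in> E" "a \<noteq> b"
  shows "\<exists>k l. k \<noteq> l \<and> k \<notin> {a, b} \<and> l \<notin> {a, b} \<and> {a, b, k} \<in> F \<and> {a, b, l} \<in> F"
proof (rule ccontr)
  let ?X = "geometric_realization E F"
  assume "\<not> ?thesis"
  then have one: "k = l" if "k \<notin> {a, b}" "l \<notin> {a, b}" "{a, b, k} \<in> F" "{a, b, l} \<in> F" for k l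
    using that by blast
  have cpx: "simplicial_2_complex E F"
    using M(2) by (simp add: triangulates_def)
  define U where "U = {x \<in> ?X. 0 < x $ a \<and> 0 < x $ b}"
  define g :: "real ^ 'v \<Rightarrow> real \<times> real" where "g x = (x $ a - x $ b, 1 - (x $ a + x $ b))" for x
  obtain N W h k where ch: "openin (top_of_set ?X) N" "edge_midpoint a b \<in> N"
    "open (W :: (real ^ 2) set)" "homeomorphism N W h k"
    using realization_chart[OF M edge_midpoint_in_realization[OF e, of F]] by blast
  have "inj_on g U"
  proof (rule inj_onI)
    fix x y assume xy: "x \<in> U" "y \<in> U" "g x = g y"
    then have ab: "x $ a = y $ a" "x $ b = y $ b"
      by (auto simp: g_def)
    have x: "x \<in> ?X" "0 < x $ a" "0 < x $ b" and y: "y \<in> ?X" "0 < y $ a" "0 < y $ b"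
      using xy by (auto simp: U_def)
    have agree: "x = y" if "{i. x $ i \<noteq> 0} = S" "{i. y $ i \<noteq> 0} = S" "\<And>i. i \<in> S \<Longrightarrow> x $ i = y $ i" for S
      unfolding vec_eq_iff
    proof
      fix i show "x $ i = y $ i"
        by (metis (mono_tags, lifting) mem_Collect_eq that)
    qed
    show "x = y"
    proof (cases rule: edge_star_coordinates[OF cpx e(2) x])
      case x1: 1
      show ?thesis
      proof (cases rule: edge_star_coordinates[OF cpx e(2) y])
        case 1
        then show ?thesis
          using ab agree[OF x1(1) 1(1)] by blast
      next
        case 2
        then show ?thesis
          using ab x1(2) 2(5,6) by linarith
      qed
    next
      case x2: (2 k)
      show ?thesis
      proof (cases rule: edge_star_coordinates[OF cpx e(2) y])
        case 1
        then show ?thesis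
          using ab x2(5,6) 1(2) by linarith
      next
        case (2 l)
        have "k = l"
          using one[of k l] x2(1-3) 2(1-3) by auto
        then have "x $ k = y $ k"
          using ab x2(5) 2(5) by simp
        then show ?thesis
          using ab agree[OF x2(4)] 2(4) \<open>k = l\<close> by blast
      qed
    qed
  qed
  moreover have "continuous_on U g"
    unfolding g_def by (intro continuous_intros)
  ultimately have op: "open (g ` (U \<inter> N))"
    using planar_image_open[OF ch(1,3,4), of U g] edge_star_open[of E F a b] by (auto simp: U_def)
  have "edge_midpoint a b \<in> U"
    using edge_midpoint_in_realization[OF e] by (auto simp: U_def edge_midpoint_def)
  moreover have "g (edge_midpoint a b) = (0, 0)"
    using e by (simp add: g_def edge_midpoint_def)
  ultimately have "(0, 0) \<in> g ` (U \<inter> N)"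
    using ch(2) by (metis IntI image_eqI)
  then obtain d where d: "0 < d" "ball (0, 0) d \<subseteq> g ` (U \<inter> N)"
    using op by (meson open_contains_ball)
  \<comment> \<open>An open image would reach below the boundary line, to a point with \<open>x $ a + x $ b > 1\<close>.\<close>
  have "(0, - d / 2) \<in> ball (0 :: real, 0 :: real) d"
    using d(1) by (simp add: dist_Pair_Pair)
  then obtain x where x: "x \<in> U" "g x = (0, - d / 2)"
    using d(2) by auto
  have "x $ a + x $ b \<le> 1"
    using x(1) by (auto simp: U_def elim: edge_star_coordinates[OF cpx e(2)])
  then show False
    using x(2) d(1) by (auto simp: g_def)
qed

text \<open>
  Two pages form a planar patch around the midpoint of the edge, which is therefore open in the
  surface. The points \<open>y \<epsilon>\<close> of a third page converge to the midpoint without entering the patch.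
\<close>

lemma no_three_pages_at_edge:
  fixes E F :: "'v::finite set set"
  assumes M: "closed_surface (M :: 'm topology)" "triangulates E F M" and e: "{a, b} \<in> E" "a \<noteq> b"
    and pages: "k \<notin> {a, b}" "l \<notin> {a, b}" "m \<notin> {a, b}" "k \<noteq> l" "k \<noteq> m" "l \<noteq> m"
      "{a, b, k} \<in> F" "{a, b, l} \<in> F" "{a, b, m} \<in> F"
  shows False
proof -
  let ?X = "geometric_realization E F"
  define B :: "(real \<times> real) set" where "B = {-1/4<..<1/4} \<times> {-1/4<..<1/4}"
  define \<psi> :: "real \<times> real \<Rightarrow> real ^ 'v" where
    "\<psi> p = (\<chi> i. if i = a then (1 - \<bar>snd p\<bar>) / 2 + fst p else if i = b then (1 - \<bar>snd p\<bar>) / 2 - fst p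
        else if i = k then max (snd p) 0 else if i = l then max (- snd p) 0 else 0)" for p
  define y :: "real \<Rightarrow> real ^ 'v" where
    "y \<epsilon> = (\<chi> i. if i = a \<or> i = b then (1 - \<epsilon>) / 2 else if i = m then \<epsilon> else 0)" for \<epsilon>
  obtain N W h g where ch: "openin (top_of_set ?X) N" "edge_midpoint a b \<in> N"
    "open (W :: (real ^ 2) set)" "homeomorphism N W h g"
    using realization_chart[OF M edge_midpoint_in_realization[OF e, of F]] by blast
  have open_B: "open B"
    unfolding B_def by (intro open_Times) auto
  have "continuous_on B (\<lambda>p. \<psi> p $ i)" for i
    unfolding \<psi>_def by (cases "i = a"; cases "i = b"; cases "i = k"; cases "i = l") (auto intro!: continuous_intros)
  then have cont: "continuous_on B \<psi>"
    by (subst continuous_on_componentwise) (auto simp: Basis_vec_def inner_axis)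
  have "inj_on \<psi> B"
  proof (rule inj_onI)
    fix p q assume eq: "\<psi> p = \<psi> q"
    have "\<psi> p $ a = \<psi> q $ a" "\<psi> p $ k = \<psi> q $ k" "\<psi> p $ l = \<psi> q $ l"
      using eq by simp_all
    then show "p = q"
      using pages e by (auto simp: \<psi>_def prod_eq_iff max_def split: if_splits)
  qed
  moreover have "\<psi> ` B \<subseteq> ?X"
  proof clarify
    fix s t assume "(s, t) \<in> B"
    then have st: "- (1/4) < s" "s < 1/4" "\<bar>t\<bar> < 1/4"
      by (auto simp: B_def)
    define p where "p = \<psi> (s, t)"
    have val: "p $ a = (1 - \<bar>t\<bar>) / 2 + s" "p $ b = (1 - \<bar>t\<bar>) / 2 - s" "p $ k = max t 0" "p $ l = max (- t) 0"
      "\<And>i. i \<notin> {a, b, k, l} \<Longrightarrow> p $ i = 0"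
      using pages e by (auto simp: p_def \<psi>_def)
    have "3 / 8 < (1 - \<bar>t\<bar>) / 2"
      using st(3) by simp
    then have posab: "0 < p $ a" "0 < p $ b"
      using val(1,2) st by linarith+
    then have "0 \<le> p $ i" for i
      using val(3-5) by (cases "i \<in> {a, b, k, l}") auto
    moreover have "(\<Sum>i\<in>UNIV. p $ i) = (\<Sum>i\<in>{a, b, k, l}. p $ i)"
      using val by (intro sum.mono_neutral_right) auto
    moreover have "(\<Sum>i\<in>{a, b, k, l}. p $ i) = 1"
      using pages e val by (auto simp: max_def)
    moreover have "{i. p $ i \<noteq> 0} = (if t = 0 then {a, b} else if t > 0 then {a, b, k} else {a, b, l})"
    proof -
      have "p $ a \<noteq> 0" "p $ b \<noteq> 0"
        using posab by auto
      then show ?thesis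
        using val(3-5) by (auto simp: max_def split: if_splits)
    qed
    ultimately show "\<psi> (s, t) \<in> ?X"
      using pages e unfolding p_def[symmetric] geometric_realization_def by auto
  qed
  ultimately have "openin (top_of_set ?X) (\<psi> ` B \<inter> N)"
    using planar_patch_open[OF ch(1,3,4) open_B cont] by blast
  then obtain T where T: "open T" "\<psi> ` B \<inter> N = ?X \<inter> T"
    by (auto simp: openin_open)
  have "\<psi> (0, 0) = edge_midpoint a b"
    by (auto simp: \<psi>_def edge_midpoint_def vec_eq_iff)
  moreover have "(0, 0) \<in> B"
    by (simp add: B_def)
  ultimately have "edge_midpoint a b \<in> \<psi> ` B \<inter> N"
    using ch(2) by (metis IntI image_eqI)
  moreover have y0: "y 0 = edge_midpoint a b"
    by (auto simp: y_def edge_midpoint_def vec_eq_iff)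
  ultimately have "y 0 \<in> T"
    using T(2) by auto
  have "((\<lambda>\<epsilon>. y \<epsilon> $ i) \<longlongrightarrow> y 0 $ i) (at_right 0)" for i
    unfolding y_def by (cases "i = m") (auto intro!: tendsto_eq_intros)
  then have "(y \<longlongrightarrow> y 0) (at_right 0)"
    by (rule vec_tendstoI)
  then have "\<forall>\<^sub>F \<epsilon> in at_right 0. y \<epsilon> \<in> T"
    using \<open>open T\<close> \<open>y 0 \<in> T\<close> by (rule topological_tendstoD)
  moreover have "\<forall>\<^sub>F \<epsilon> in at_right 0. (0::real) < \<epsilon> \<and> \<epsilon> < 1"
    using eventually_at_right_less[of "0::real"] eventually_at_right[of 0 1] 
    by (auto simp: eventually_at_right[of 0 1] intro!: exI[of _ 1])
  ultimately have "\<forall>\<^sub>F \<epsilon> in at_right 0. y \<epsilon> \<in> T \<and> 0 < \<epsilon> \<and> \<epsilon> < 1"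
    by (rule eventually_conj)
  then obtain \<epsilon> where eps: "y \<epsilon> \<in> T" "0 < \<epsilon>" "\<epsilon> < 1"
    using eventually_happens'[OF trivial_limit_at_right_real] by blast
  have "y \<epsilon> \<in> ?X"
  proof -
    have val: "y \<epsilon> $ a = (1 - \<epsilon>) / 2" "y \<epsilon> $ b = (1 - \<epsilon>) / 2" "y \<epsilon> $ m = \<epsilon>" "\<And>i. i \<notin> {a, b, m} \<Longrightarrow> y \<epsilon> $ i = 0"
      using pages by (auto simp: y_def)
    have "0 \<le> y \<epsilon> $ i" for i
      using val eps by (cases "i \<in> {a, b, m}") auto
    moreover have "(\<Sum>i\<in>UNIV. y \<epsilon> $ i) = (\<Sum>i\<in>{a, b, m}. y \<epsilon> $ i)"
      using val by (intro sum.mono_neutral_right) auto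
    moreover have "(\<Sum>i\<in>{a, b, m}. y \<epsilon> $ i) = 1"
      using pages e val by (auto simp: field_simps)
    moreover have "{i. y \<epsilon> $ i \<noteq> 0} = {a, b, m}"
      using val eps by auto
    ultimately show ?thesis
      using pages by (auto simp: geometric_realization_def)
  qed
  then have "y \<epsilon> \<in> \<psi> ` B"
    using T(2) eps(1) by blast
  then have "y \<epsilon> $ m = 0"
    using pages by (auto simp: \<psi>_def)
  then show False
    using pages eps by (simp add: y_def)
qed

lemma card_faces_at_edge:
  fixes E F :: "'v::finite set set"
  assumes M: "closed_surface (M :: 'm topology)" "triangulates E F M" and "e \<in> E"
  shows "card {f \<in> F. e \<subseteq> f} = 2"
proof -
  have cpx: "\<And>e. e \<in> E \<Longrightarrow> card e = 2" "\<And>f. f \<in> F \<Longrightarrow> card f = 3"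
    using M(2) by (auto simp: triangulates_def simplicial_2_complex_def)
  obtain a b where ab: "e = {a, b}" "a \<noteq> b"
    using cpx(1)[OF \<open>e \<in> E\<close>] by (auto simp: card_2_iff)
  have e: "{a, b} \<in> E"
    using ab \<open>e \<in> E\<close> by simp
  obtain k l where kl: "k \<noteq> l" "k \<notin> {a, b}" "l \<notin> {a, b}" "{a, b, k} \<in> F" "{a, b, l} \<in> F"
    using two_pages_at_edge[OF M e ab(2)] by blast
  have "f = {a, b, k} \<or> f = {a, b, l}" if f: "f \<in> F" "e \<subseteq> f" for f
  proof -
    have "card (f - {a, b}) = 1"
      using cpx(2)[OF f(1)] f(2) ab by (simp add: card_Diff_subset)
    then obtain m where "f - {a, b} = {m}"
      by (auto simp: card_1_singleton_iff)
    then have m: "f = {a, b, m}" "m \<notin> {a, b}"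
      using f ab by auto
    then have "m = k \<or> m = l"
      using no_three_pages_at_edge[OF M e ab(2) kl(2,3) m(2) kl(1) _ _ kl(4,5)] f(1) by blast
    then show ?thesis
      using m by auto
  qed
  then have "{f \<in> F. e \<subseteq> f} = {{a, b, k}, {a, b, l}}"
    using kl ab by auto
  moreover have "{a, b, k} \<noteq> {a, b, l}"
    using kl by auto
  ultimately show ?thesis
    by simp
qed

text \<open>
  Incident pairs of an edge and a face are counted in both ways.
\<close>

lemma two_edges_eq_three_faces:
  fixes E F :: "'v::finite set set"
  assumes M: "closed_surface (M :: 'm topology)" "triangulates E F M"
  shows "2 * card E = 3 * card F"
proof -
  have cpx: "\<And>e. e \<in> E \<Longrightarrow> card e = 2" "\<And>f. f \<in> F \<Longrightarrow> card f = 3"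
      "\<And>f e. f \<in> F \<Longrightarrow> e \<subseteq> f \<Longrightarrow> card e = 2 \<Longrightarrow> e \<in> E"
    using M(2) by (auto simp: triangulates_def simplicial_2_complex_def)
  have "card {e \<in> E. e \<subseteq> f} = 3" if "f \<in> F" for f
  proof -
    have "{e \<in> E. e \<subseteq> f} = {e. e \<subseteq> f \<and> card e = 2}"
      using cpx that by auto
    then show ?thesis
      using n_subsets[of f 2] cpx(2)[OF that] by (simp add: numeral_eq_Suc binomial_Suc_Suc)
  qed
  then have "(\<Sum>e\<in>E. card {f \<in> F. e \<subseteq> f}) = 3 * card F"
    by (intro sum_multicount) auto
  moreover have "(\<Sum>e\<in>E. card {f \<in> F. e \<subseteq> f}) = (\<Sum>e\<in>E. 2)"
    using card_faces_at_edge[OF M] by (intro sum.cong) auto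
  ultimately show ?thesis
    by simp
qed

text \<open>
  If no face met both \<open>A\<close> and its complement, then no edge would do so either, every edge lying in a
  face; the points supported in \<open>A\<close> and those supported outside \<open>A\<close> would disconnect the realization.
\<close>

lemma face_across_cut:
  fixes E F :: "'v::finite set set"
  assumes M: "closed_surface (M :: 'm topology)" "triangulates E F M" and "connected_space M"
    and A: "A \<noteq> {}" "A \<noteq> UNIV"
  shows "\<exists>f\<in>F. \<exists>a b. a \<in> f \<and> b \<in> f \<and> a \<in> A \<and> b \<notin> A"
proof (rule ccontr)
  let ?X = "geometric_realization E F"
  assume no: "\<not> ?thesis"
  have cpx: "simplicial_2_complex E F"
    using M(2) by (simp add: triangulates_def)
  have "connected_space (top_of_set ?X)"
    using M(2) \<open>connected_space M\<close> homeomorphic_connected_space by (auto simp: triangulates_def)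
  then have conn: "connected ?X"
    by (metis connectedin_def connectedin_iff_connected topspace_euclidean subset_UNIV)
  \<comment> \<open>\<open>P S\<close> is the set of points supported outside \<open>S\<close>.\<close>
  define P where "P S = (\<Inter>i\<in>S. {x :: real ^ 'v. x $ i = 0})" for S
  have closed: "closed (P S)" for S
    unfolding P_def by (intro closed_INT ballI closed_Collect_eq continuous_intros)
  have noE: "S \<subseteq> A \<or> S \<subseteq> - A" if S: "S \<in> range (\<lambda>i. {i}) \<union> E \<union> F" for S
  proof -
    have "S \<subseteq> A \<or> S \<subseteq> - A" if "S \<in> E"
    proof -
      have "card {f \<in> F. S \<subseteq> f} = 2"
        using card_faces_at_edge[OF M that] .
      then obtain f where "f \<in> F" "S \<subseteq> f"
        by (metis (no_types, lifting) card.empty empty_Collect_eq zero_neq_numeral)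
      then show ?thesis
        using no by blast
    qed
    then show ?thesis
      using S no by blast
  qed
  have "?X \<subseteq> P A \<union> P (- A)"
  proof
    fix x assume "x \<in> ?X"
    then have "{i. x $ i \<noteq> 0} \<subseteq> A \<or> {i. x $ i \<noteq> 0} \<subseteq> - A"
      using noE by (auto simp: geometric_realization_def)
    then show "x \<in> P A \<union> P (- A)"
      by (auto simp: P_def)
  qed
  moreover have "P A \<inter> P (- A) \<inter> ?X = {}"
  proof -
    have "x = 0" if "x \<in> P A \<inter> P (- A)" for x
      using that by (auto simp: P_def vec_eq_iff)
    moreover have "0 \<notin> ?X"
      by (simp add: geometric_realization_def)
    ultimately show ?thesis
      by blast
  qed
  moreover have ax: "axis i 1 \<in> ?X" for i
  proof -
    have "{j. axis i (1::real) $ j \<noteq> 0} = {i}"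
      by (auto simp: axis_def)
    moreover have "(\<Sum>j\<in>UNIV. axis i (1::real) $ j) = 1"
      by (simp add: axis_def)
    ultimately show ?thesis
      by (auto simp: geometric_realization_def axis_def)
  qed
  moreover obtain i j where ij: "i \<in> A" "j \<notin> A"
    using A by blast
  have "axis i 1 \<in> P (- A) \<inter> ?X" "axis j 1 \<in> P A \<inter> ?X"
    using ij ax by (auto simp: P_def axis_def)
  ultimately show False
    using conn closed unfolding connected_closed by blast
qed

section \<open>Total curvature and monotonicity of the curvature\<close>

lemma inner_angle_eq_cp_angle:
  "inner_angle \<Phi> r i j k =
     cp_angle (r $ i) (r $ j) (r $ k) (cos (\<Phi> {j, k})) (cos (\<Phi> {i, k})) (cos (\<Phi> {i, j}))"
  by (simp add: inner_angle_def edge_length_def cp_angle_def sqlen_def)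

definition nonobtuse_weights :: "'v set set \<Rightarrow> ('v set \<Rightarrow> real) \<Rightarrow> bool" where
  "nonobtuse_weights E \<Phi> \<longleftrightarrow> (\<forall>e\<in>E. 0 \<le> \<Phi> e \<and> \<Phi> e \<le> pi / 2)"

lemma face_vertices:
  assumes "simplicial_2_complex E F" "nonobtuse_weights E \<Phi>" "f \<in> F"
  obtains i j k where "f = {i, j, k}" "i \<noteq> j" "i \<noteq> k" "j \<noteq> k"
    "cos (\<Phi> {j, k}) \<in> {0..1}" "cos (\<Phi> {i, k}) \<in> {0..1}" "cos (\<Phi> {i, j}) \<in> {0..1}"
    "\<And>r. face_angle \<Phi> r f i = cp_angle (r $ i) (r $ j) (r $ k) (cos (\<Phi> {j, k})) (cos (\<Phi> {i, k})) (cos (\<Phi> {i, j}))"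
    "\<And>r. face_angle \<Phi> r f j = cp_angle (r $ j) (r $ i) (r $ k) (cos (\<Phi> {i, k})) (cos (\<Phi> {j, k})) (cos (\<Phi> {i, j}))"
    "\<And>r. face_angle \<Phi> r f k = cp_angle (r $ k) (r $ i) (r $ j) (cos (\<Phi> {i, j})) (cos (\<Phi> {j, k})) (cos (\<Phi> {i, k}))"
proof -
  obtain i j k where f: "f = {i, j, k}" "i \<noteq> j" "i \<noteq> k" "j \<noteq> k"
    using assms(1,3) by (auto simp: simplicial_2_complex_def card_3_iff)
  have "cos (\<Phi> {v, w}) \<in> {0..1}" if "{v, w} \<subseteq> f" "v \<noteq> w" for v w
  proof -
    have "{v, w} \<in> E"
      using assms(1,3) that by (auto simp: simplicial_2_complex_def)
    then have "0 \<le> \<Phi> {v, w}" "\<Phi> {v, w} \<le> pi / 2"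
      using assms(2) by (auto simp: nonobtuse_weights_def)
    then show ?thesis
      by (auto intro: cos_ge_zero)
  qed
  then have c: "cos (\<Phi> {j, k}) \<in> {0..1}" "cos (\<Phi> {i, k}) \<in> {0..1}" "cos (\<Phi> {i, j}) \<in> {0..1}"
    using f by blast+
  have perm: "f = {j, i, k}" "f = {k, i, j}"
    using f by auto
  have "face_angle \<Phi> r f i = inner_angle \<Phi> r i j k" "face_angle \<Phi> r f j = inner_angle \<Phi> r j i k"
    "face_angle \<Phi> r f k = inner_angle \<Phi> r k i j" for r
    using face_angle_eq[of i j k \<Phi> r] face_angle_eq[of j i k \<Phi> r] face_angle_eq[of k i j \<Phi> r] f perm
    by (metis card_3_iff)+
  then show ?thesis
    using that[OF f c] by (simp add: inner_angle_eq_cp_angle insert_commute)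
qed

lemma face_angle_sum:
  assumes "simplicial_2_complex E F" "nonobtuse_weights E \<Phi>" "f \<in> F" "circle_packing_metric r"
  shows "(\<Sum>i\<in>f. face_angle \<Phi> r f i) = pi"
proof -
  obtain i j k where f: "f = {i, j, k}" "i \<noteq> j" "i \<noteq> k" "j \<noteq> k"
    and c: "cos (\<Phi> {j, k}) \<in> {0..1}" "cos (\<Phi> {i, k}) \<in> {0..1}" "cos (\<Phi> {i, j}) \<in> {0..1}"
    and angle: "\<And>r. face_angle \<Phi> r f i = cp_angle (r $ i) (r $ j) (r $ k) (cos (\<Phi> {j, k})) (cos (\<Phi> {i, k})) (cos (\<Phi> {i, j}))"
    "\<And>r. face_angle \<Phi> r f j = cp_angle (r $ j) (r $ i) (r $ k) (cos (\<Phi> {i, k})) (cos (\<Phi> {j, k})) (cos (\<Phi> {i, j}))"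
    "\<And>r. face_angle \<Phi> r f k = cp_angle (r $ k) (r $ i) (r $ j) (cos (\<Phi> {i, j})) (cos (\<Phi> {j, k})) (cos (\<Phi> {i, k}))"
    using face_vertices[OF assms(1-3)] by metis
  have "(\<Sum>v\<in>f. face_angle \<Phi> r f v) = face_angle \<Phi> r f i + face_angle \<Phi> r f j + face_angle \<Phi> r f k"
    using f(2-4) by (subst (1) f(1)) simp
  then show ?thesis
    using assms(4) cp_angle_sum[OF _ _ _ c, of "r $ i" "r $ j" "r $ k"]
    by (simp add: angle circle_packing_metric_def)
qed

lemma face_angle_tendsto:
  assumes "simplicial_2_complex E F" "nonobtuse_weights E \<Phi>" "f \<in> F" "v \<in> f"
    and "(r \<longlongrightarrow> r') G" "circle_packing_metric r'"
  shows "((\<lambda>t. face_angle \<Phi> (r t) f v) \<longlongrightarrow> face_angle \<Phi> r' f v) G"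
proof -
  obtain i j k where f: "f = {i, j, k}"
    and c: "cos (\<Phi> {j, k}) \<in> {0..1}" "cos (\<Phi> {i, k}) \<in> {0..1}" "cos (\<Phi> {i, j}) \<in> {0..1}"
    and angle: "\<And>r. face_angle \<Phi> r f i = cp_angle (r $ i) (r $ j) (r $ k) (cos (\<Phi> {j, k})) (cos (\<Phi> {i, k})) (cos (\<Phi> {i, j}))"
    "\<And>r. face_angle \<Phi> r f j = cp_angle (r $ j) (r $ i) (r $ k) (cos (\<Phi> {i, k})) (cos (\<Phi> {j, k})) (cos (\<Phi> {i, j}))"
    "\<And>r. face_angle \<Phi> r f k = cp_angle (r $ k) (r $ i) (r $ j) (cos (\<Phi> {i, j})) (cos (\<Phi> {j, k})) (cos (\<Phi> {i, k}))"
    using face_vertices[OF assms(1-3)] by metis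
  have "((\<lambda>t. face_angle \<Phi> (r t) f w) \<longlongrightarrow> face_angle \<Phi> r' f w) G" if "w = i \<or> w = j \<or> w = k" for w
    using that assms(6) c unfolding circle_packing_metric_def
    by (elim disjE) (auto simp: angle intro!: cp_angle_tendsto tendsto_vec_nth assms(5))
  then show ?thesis
    using assms(4) f by auto
qed

lemma gauss_curvature_tendsto:
  assumes "simplicial_2_complex E F" "nonobtuse_weights E \<Phi>"
    and "(r \<longlongrightarrow> r') G" "circle_packing_metric r'"
  shows "((\<lambda>t. gauss_curvature F \<Phi> (r t) i) \<longlongrightarrow> gauss_curvature F \<Phi> r' i) G"
  unfolding gauss_curvature_def
  by (intro tendsto_intros face_angle_tendsto[OF assms(1,2) _ _ assms(3,4)]) auto

text \<open>
  Summation over vertices becomes summation over faces, so that everything can be checked on a single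
  triangle.
\<close>

lemma sum_gauss_curvature_weighted:
  "(\<Sum>i\<in>UNIV. gauss_curvature F \<Phi> r i * w $ i) =
     2 * pi * (\<Sum>i\<in>UNIV. w $ i) - (\<Sum>f\<in>F. \<Sum>i\<in>f. face_angle \<Phi> r f i * w $ i)"
proof -
  have "(\<Sum>i\<in>UNIV. (\<Sum>f\<in>{f \<in> F. i \<in> f}. face_angle \<Phi> r f i) * w $ i) =
      (\<Sum>i\<in>UNIV. \<Sum>f\<in>{f \<in> F. i \<in> f}. face_angle \<Phi> r f i * w $ i)"
    by (simp add: sum_distrib_right)
  also have "\<dots> = (\<Sum>f\<in>F. \<Sum>i\<in>{i \<in> UNIV. i \<in> f}. face_angle \<Phi> r f i * w $ i)"
    by (rule sum.swap_restrict) auto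
  finally show ?thesis
    by (simp add: gauss_curvature_def left_diff_distrib sum_subtractf sum_distrib_left)
qed

lemma gauss_bonnet:
  assumes "simplicial_2_complex E F" "nonobtuse_weights E \<Phi>" "2 * card E = 3 * card F" "circle_packing_metric r"
  shows "(\<Sum>i\<in>UNIV. gauss_curvature F \<Phi> r i) = 2 * pi * euler_char E F"
proof -
  have "(\<Sum>f\<in>F. \<Sum>i\<in>f. face_angle \<Phi> r f i) = (\<Sum>f\<in>F. pi)"
    using face_angle_sum[OF assms(1,2) _ assms(4)] by (intro sum.cong) auto
  then have "(\<Sum>i\<in>UNIV. gauss_curvature F \<Phi> r i) = 2 * pi * CARD('a) - pi * card F"
    using sum_gauss_curvature_weighted[of F \<Phi> r "\<chi> i. 1"] by simp
  moreover have "real (card E) = 3 / 2 * card F"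
    using assms(3) by linarith
  ultimately show ?thesis
    by (simp add: euler_char_def algebra_simps)
qed

text \<open>
  Logarithmic coordinates, in which the Jacobian of the curvature is symmetric.
\<close>

definition radii :: "real ^ 'v::finite \<Rightarrow> real ^ 'v" where
  "radii u = (\<chi> i. exp (u $ i))"

text \<open>
  The properties of the quadratic form by which the angles of a face \<open>f\<close> change: it depends on a
  base point \<open>u\<close> and is evaluated on a direction \<open>w\<close>, and only directions constant on \<open>f\<close> are null.
\<close>

definition dirichlet_form :: "('v::finite) set \<Rightarrow> (real ^ 'v \<Rightarrow> real ^ 'v \<Rightarrow> real) \<Rightarrow> bool" where
  "dirichlet_form f Q \<longleftrightarrow> 
   continuous_on UNIV (\<lambda>p. Q (fst p) (snd p)) \<and>
   (\<forall>u w. 0 \<le> Q u w) \<and> (\<forall>u w s. Q u (s *\<^sub>R w) = s\<^sup>2 * Q u w) \<and>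
   (\<forall>u w. Q u w = 0 \<longrightarrow> (\<forall>i\<in>f. \<forall>j\<in>f. w $ i = w $ j))"

lemma continuous_on_coupling:
  assumes "continuous_on S X" "continuous_on S Y" "continuous_on S Z"
    and "\<And>p. p \<in> S \<Longrightarrow> 0 < X p" "\<And>p. p \<in> S \<Longrightarrow> 0 < Y p" "\<And>p. p \<in> S \<Longrightarrow> 0 < Z p"
    and "a \<in> {0..1}" "b \<in> {0..1}" "c \<in> {0..1}"
  shows "continuous_on S (\<lambda>p. coupling (X p) (Y p) (Z p) a b c)"
proof -
  have h: "0 < heron (X p) (Y p) (Z p) a b c" "0 < sqlen (X p) (Y p) c" if "p \<in> S" for p
    using that assms by (auto intro!: heron_pos sqlen_pos)
  have "continuous_on S (\<lambda>p. heron (X p) (Y p) (Z p) a b c)" "continuous_on S (\<lambda>p. sqlen (X p) (Y p) c)"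
    unfolding heron_def sqlen_def by (intro continuous_intros assms)+
  moreover have "sqlen (X p) (Y p) c * sqrt (heron (X p) (Y p) (Z p) a b c) \<noteq> 0" if "p \<in> S" for p
    using h[OF that] by simp
  ultimately show ?thesis
    unfolding coupling_def by (intro continuous_intros assms ballI)
qed

text \<open>
  By symmetry of the couplings the derivative collects to minus the sum of
  \<open>coupling * (difference of w)\<^sup>2\<close> over the three edges. At least two of the couplings are positive,
  which already connects the three vertices.
\<close>

lemma face_dirichlet_form:
  assumes "simplicial_2_complex E F" "nonobtuse_weights E \<Phi>" "f \<in> F"
  shows "\<exists>Q. dirichlet_form f Q \<and>
   (\<forall>u w t. ((\<lambda>\<tau>. \<Sum>i\<in>f. face_angle \<Phi> (radii (u + \<tau> *\<^sub>R w)) f i * w $ i) has_real_derivative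
      - Q (u + t *\<^sub>R w) w) (at t))"
proof -
  obtain i j k where f: "f = {i, j, k}" "i \<noteq> j" "i \<noteq> k" "j \<noteq> k"
    and c: "cos (\<Phi> {j, k}) \<in> {0..1}" "cos (\<Phi> {i, k}) \<in> {0..1}" "cos (\<Phi> {i, j}) \<in> {0..1}"
    and angle: "\<And>r. face_angle \<Phi> r f i = cp_angle (r $ i) (r $ j) (r $ k) (cos (\<Phi> {j, k})) (cos (\<Phi> {i, k})) (cos (\<Phi> {i, j}))"
    "\<And>r. face_angle \<Phi> r f j = cp_angle (r $ j) (r $ i) (r $ k) (cos (\<Phi> {i, k})) (cos (\<Phi> {j, k})) (cos (\<Phi> {i, j}))"
    "\<And>r. face_angle \<Phi> r f k = cp_angle (r $ k) (r $ i) (r $ j) (cos (\<Phi> {i, j})) (cos (\<Phi> {j, k})) (cos (\<Phi> {i, k}))"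
    using face_vertices[OF assms(1-3)] by metis
  define A B C where abc: "A = cos (\<Phi> {j, k})" "B = cos (\<Phi> {i, k})" "C = cos (\<Phi> {i, j})"
  note c' = c[folded abc]
  define cij where "cij u = coupling (exp (u $ i)) (exp (u $ j)) (exp (u $ k)) A B C" for u :: "real ^ 'a"
  define cik where "cik u = coupling (exp (u $ i)) (exp (u $ k)) (exp (u $ j)) A C B" for u :: "real ^ 'a"
  define cjk where "cjk u = coupling (exp (u $ j)) (exp (u $ k)) (exp (u $ i)) B C A" for u :: "real ^ 'a"
  define Q where "Q u w = cij u * (w $ i - w $ j)\<^sup>2 + cik u * (w $ i - w $ k)\<^sup>2 + cjk u * (w $ j - w $ k)\<^sup>2"
    for u w :: "real ^ 'a"
  have nn: "0 \<le> cij u" "0 \<le> cik u" "0 \<le> cjk u" for u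
    unfolding cij_def cik_def cjk_def by (rule coupling_nonneg; use c' in simp)+
  have "continuous_on UNIV (\<lambda>p. Q (fst p) (snd p))"
    unfolding Q_def cij_def cik_def cjk_def
    by (intro continuous_intros continuous_on_coupling) (use c' in auto)
  moreover have "0 \<le> Q u w" for u w
    unfolding Q_def using nn by simp
  moreover have "Q u (s *\<^sub>R w) = s\<^sup>2 * Q u w" for u w s
    unfolding Q_def vector_scaleR_component real_scaleR_def by algebra
  moreover have "\<forall>v\<in>f. \<forall>v'\<in>f. w $ v = w $ v'" if "Q u w = 0" for u w
  proof -
    have "cij u * (w $ i - w $ j)\<^sup>2 = 0 \<and> cik u * (w $ i - w $ k)\<^sup>2 = 0 \<and> cjk u * (w $ j - w $ k)\<^sup>2 = 0"
      using that nn[of u] unfolding Q_def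
      by (smt (verit) mult_nonneg_nonneg zero_le_power2)
    then have z: "cij u = 0 \<or> w $ i = w $ j" "cik u = 0 \<or> w $ i = w $ k" "cjk u = 0 \<or> w $ j = w $ k"
      by auto
    have "A = 0 \<and> B = 0 \<and> C = 1" if "cij u = 0"
      by (intro conjI; rule coupling_eq_0D[OF that[unfolded cij_def]]; use c' in simp)
    moreover have "A = 0 \<and> C = 0 \<and> B = 1" if "cik u = 0"
      by (intro conjI; rule coupling_eq_0D[OF that[unfolded cik_def]]; use c' in simp)
    moreover have "B = 0 \<and> C = 0 \<and> A = 1" if "cjk u = 0"
      by (intro conjI; rule coupling_eq_0D[OF that[unfolded cjk_def]]; use c' in simp)
    ultimately have "w $ i = w $ j \<and> w $ i = w $ k"
      using z by (metis zero_neq_one)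
    then show ?thesis
      unfolding f(1) by auto
  qed
  moreover have "((\<lambda>\<tau>. \<Sum>i\<in>f. face_angle \<Phi> (radii (u + \<tau> *\<^sub>R w)) f i * w $ i) has_real_derivative
      - Q (u + t *\<^sub>R w) w) (at t)" for u w :: "real ^ 'a" and t
  proof -
    let ?u = "u + t *\<^sub>R w"
    have d: "((\<lambda>\<tau>. exp (u $ v + \<tau> * w $ v)) has_real_derivative exp (u $ v + t * w $ v) * w $ v) (at t)" for v
      by (auto intro!: derivative_eq_intros)
    have "((\<lambda>\<tau>. cp_angle (exp (u $ i + \<tau> * w $ i)) (exp (u $ j + \<tau> * w $ j)) (exp (u $ k + \<tau> * w $ k)) A B C)
        has_real_derivative cij ?u * (w $ j - w $ i) + cik ?u * (w $ k - w $ i)) (at t)"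
      using cp_angle_has_derivative[OF d d d _ _ _ c'] by (simp add: cij_def cik_def)
    moreover have "((\<lambda>\<tau>. cp_angle (exp (u $ j + \<tau> * w $ j)) (exp (u $ i + \<tau> * w $ i)) (exp (u $ k + \<tau> * w $ k)) B A C)
        has_real_derivative cij ?u * (w $ i - w $ j) + cjk ?u * (w $ k - w $ j)) (at t)"
      using cp_angle_has_derivative[OF d d d _ _ _ c'(2,1,3)]
      by (simp add: cij_def cjk_def coupling_commute[of "exp (u $ i + t * w $ i)" "exp (u $ j + t * w $ j)"])
    moreover have "((\<lambda>\<tau>. cp_angle (exp (u $ k + \<tau> * w $ k)) (exp (u $ i + \<tau> * w $ i)) (exp (u $ j + \<tau> * w $ j)) C A B)
        has_real_derivative cik ?u * (w $ i - w $ k) + cjk ?u * (w $ j - w $ k)) (at t)"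
      using cp_angle_has_derivative[OF d d d _ _ _ c'(3,1,2)]
      by (simp add: cik_def cjk_def coupling_commute[of "exp (u $ i + t * w $ i)" "exp (u $ k + t * w $ k)"]
          coupling_commute[of "exp (u $ j + t * w $ j)" "exp (u $ k + t * w $ k)"])
    ultimately have "((\<lambda>\<tau>. cp_angle (exp (u $ i + \<tau> * w $ i)) (exp (u $ j + \<tau> * w $ j)) (exp (u $ k + \<tau> * w $ k)) A B C * w $ i
      + cp_angle (exp (u $ j + \<tau> * w $ j)) (exp (u $ i + \<tau> * w $ i)) (exp (u $ k + \<tau> * w $ k)) B A C * w $ j
      + cp_angle (exp (u $ k + \<tau> * w $ k)) (exp (u $ i + \<tau> * w $ i)) (exp (u $ j + \<tau> * w $ j)) C A B * w $ k)
      has_real_derivative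
        (cij ?u * (w $ j - w $ i) + cik ?u * (w $ k - w $ i)) * w $ i
        + (cij ?u * (w $ i - w $ j) + cjk ?u * (w $ k - w $ j)) * w $ j
        + (cik ?u * (w $ i - w $ k) + cjk ?u * (w $ j - w $ k)) * w $ k) (at t)"
      by (intro DERIV_add DERIV_cmult_right)
    moreover have "(cij ?u * (w $ j - w $ i) + cik ?u * (w $ k - w $ i)) * w $ i
        + (cij ?u * (w $ i - w $ j) + cjk ?u * (w $ k - w $ j)) * w $ j
        + (cik ?u * (w $ i - w $ k) + cjk ?u * (w $ j - w $ k)) * w $ k = - Q ?u w"
      unfolding Q_def by algebra
    moreover have "(\<Sum>v\<in>f. h v) = h i + h j + h k" for h :: "'a \<Rightarrow> real"
      unfolding f(1) using f(2-4) by simp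
    ultimately show ?thesis
      by (simp add: angle radii_def flip: abc)
  qed
  ultimately show ?thesis
    unfolding dirichlet_form_def by (intro exI[of _ Q]) blast
qed

text \<open>
  Along a segment, the curvature tested against the direction of the segment increases at the rate of
  the total Dirichlet form \<open>Q\<close>. A null direction of \<open>Q\<close> is constant on every face, hence constant, as
  faces connect the vertices; on directions of sum zero \<open>Q\<close> is thus positive definite, and by
  compactness uniformly so over a ball. The mean value theorem turns this into the estimate.
\<close>

lemma curvature_strongly_monotone:
  fixes E F :: "'v::finite set set" and u\<^sub>0 :: "real ^ 'v"
  assumes cpx: "simplicial_2_complex E F" "nonobtuse_weights E \<Phi>"
    and conn: "\<And>A. A \<noteq> {} \<Longrightarrow> A \<noteq> UNIV \<Longrightarrow> \<exists>f\<in>F. \<exists>a b. a \<in> f \<and> b \<in> f \<and> a \<in> A \<and> b \<notin> A"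
  obtains c where "0 < c"
    "\<And>u. norm (u - u\<^sub>0) \<le> R \<Longrightarrow> (\<Sum>i\<in>UNIV. (u - u\<^sub>0) $ i) = 0 \<Longrightarrow>
      c * (norm (u - u\<^sub>0))\<^sup>2 \<le>
      (\<Sum>i\<in>UNIV. (gauss_curvature F \<Phi> (radii u) i - gauss_curvature F \<Phi> (radii u\<^sub>0) i) * (u - u\<^sub>0) $ i)"
proof -
  have "\<forall>f\<in>F. \<exists>Q. dirichlet_form f Q \<and>
     (\<forall>u w t. ((\<lambda>\<tau>. \<Sum>i\<in>f. face_angle \<Phi> (radii (u + \<tau> *\<^sub>R w)) f i * w $ i) has_real_derivative
        - Q (u + t *\<^sub>R w) w) (at t))"
    using face_dirichlet_form[OF cpx] by (intro ballI)
  from bchoice[OF this] obtain q where q: "\<And>f. f \<in> F \<Longrightarrow> dirichlet_form f (q f)"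
     "\<And>f u w t. f \<in> F \<Longrightarrow>
        ((\<lambda>\<tau>. \<Sum>i\<in>f. face_angle \<Phi> (radii (u + \<tau> *\<^sub>R w)) f i * w $ i) has_real_derivative
          - q f (u + t *\<^sub>R w) w) (at t)"
    by blast
  define Q where "Q u w = (\<Sum>f\<in>F. q f u w)" for u w
  have deriv: "((\<lambda>\<tau>. \<Sum>i\<in>UNIV. gauss_curvature F \<Phi> (radii (u + \<tau> *\<^sub>R w)) i * w $ i) has_real_derivative
      Q (u + t *\<^sub>R w) w) (at t)" for u w t
  proof -
    have "((\<lambda>\<tau>. 2 * pi * (\<Sum>i\<in>UNIV. w $ i) -
        (\<Sum>f\<in>F. \<Sum>i\<in>f. face_angle \<Phi> (radii (u + \<tau> *\<^sub>R w)) f i * w $ i)) has_real_derivative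
        0 - (\<Sum>f\<in>F. - q f (u + t *\<^sub>R w) w)) (at t)"
      by (intro DERIV_diff DERIV_const DERIV_sum q(2))
    then show ?thesis
      by (simp add: sum_gauss_curvature_weighted Q_def sum_negf)
  qed
  have cont: "continuous_on S (\<lambda>p. Q (fst p) (snd p))" for S
    unfolding Q_def using q(1)
    by (intro continuous_on_sum) (auto simp: dirichlet_form_def intro: continuous_on_subset)
  have nn: "0 \<le> Q u w" for u w
    unfolding Q_def using q(1) by (intro sum_nonneg) (auto simp: dirichlet_form_def)
  have hom: "Q u (s *\<^sub>R w) = s\<^sup>2 * Q u w" for u w s
    unfolding Q_def sum_distrib_left using q(1) by (intro sum.cong) (auto simp: dirichlet_form_def)
  have definite: "w = 0" if "Q u w = 0" "(\<Sum>i\<in>UNIV. w $ i) = 0" for u w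
  proof -
    have zero: "\<forall>f\<in>F. q f u w = 0"
    proof -
      have "0 \<le> q f u w" if "f \<in> F" for f
        using q(1)[OF that] by (simp add: dirichlet_form_def)
      then show ?thesis
        using that(1) sum_nonneg_eq_0_iff[of F "\<lambda>f. q f u w"] by (simp add: Q_def)
    qed
    have faces: "w $ a = w $ b" if "f \<in> F" "a \<in> f" "b \<in> f" for f a b
    proof -
      have "\<forall>u w. q f u w = 0 \<longrightarrow> (\<forall>i\<in>f. \<forall>j\<in>f. w $ i = w $ j)"
        using q(1)[OF that(1)] unfolding dirichlet_form_def by blast
      then show ?thesis
        using zero that by blast
    qed
    have const: "w $ i = w $ j" for i j
    proof (rule ccontr)
      assume "w $ i \<noteq> w $ j"
      then have "{l. w $ l = w $ j} \<noteq> {}" "{l. w $ l = w $ j} \<noteq> UNIV"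
        by auto
      from conn[OF this] obtain f a b where "f \<in> F" "a \<in> f" "b \<in> f" "w $ a = w $ j" "w $ b \<noteq> w $ j"
        by auto
      then show False
        using faces[of f a b] by simp
    qed
    have "w $ i = 0" for i
    proof -
      have "(\<Sum>j\<in>UNIV. w $ j) = (\<Sum>j\<in>(UNIV :: 'v set). w $ i)"
        by (intro sum.cong refl const)
      then show ?thesis
        using that(2) by simp
    qed
    then show ?thesis
      by (simp add: vec_eq_iff)
  qed
  define S where "S = {w :: real ^ 'v. norm w = 1 \<and> (\<Sum>i\<in>UNIV. w $ i) = 0}"
  have "compact S"
  proof -
    have "closed {w :: real ^ 'v. (\<Sum>i\<in>UNIV. w $ i) = 0}"
      by (intro closed_Collect_eq continuous_intros)
    moreover have "S = sphere 0 1 \<inter> {w. (\<Sum>i\<in>UNIV. w $ i) = 0}"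
      by (auto simp: S_def)
    ultimately show ?thesis
      by (auto intro: compact_Int_closed)
  qed
  \<comment> \<open>The product is empty if there is a single vertex or \<open>R < 0\<close>.\<close>
  have "\<exists>c>0. \<forall>p\<in>cball u\<^sub>0 R \<times> S. c \<le> Q (fst p) (snd p)"
  proof (cases "cball u\<^sub>0 R \<times> S = {}")
    case True
    then show ?thesis
      by (intro exI[of _ 1]) auto
  next
    case False
    obtain p where p: "p \<in> cball u\<^sub>0 R \<times> S"
      "\<And>p'. p' \<in> cball u\<^sub>0 R \<times> S \<Longrightarrow> Q (fst p) (snd p) \<le> Q (fst p') (snd p')"
      using continuous_attains_inf[OF compact_Times[OF compact_cball \<open>compact S\<close>] False cont] by blast
    have "Q (fst p) (snd p) \<noteq> 0"
      using definite[of "fst p" "snd p"] p(1) by (auto simp: S_def)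
    then show ?thesis
      using p(2) nn[of "fst p" "snd p"] by (intro exI[of _ "Q (fst p) (snd p)"]) auto
  qed
  then obtain c where c: "0 < c" "\<And>u w. u \<in> cball u\<^sub>0 R \<Longrightarrow> w \<in> S \<Longrightarrow> c \<le> Q u w"
    by auto
  show ?thesis
  proof (rule that[OF c(1)])
    fix u assume u: "norm (u - u\<^sub>0) \<le> R" "(\<Sum>i\<in>UNIV. (u - u\<^sub>0) $ i) = 0"
    define w where "w = u - u\<^sub>0"
    let ?G = "\<lambda>\<tau>. \<Sum>i\<in>UNIV. gauss_curvature F \<Phi> (radii (u\<^sub>0 + \<tau> *\<^sub>R w)) i * w $ i"
    obtain t where t: "0 < t" "t < 1" "?G 1 - ?G 0 = (1 - 0) * Q (u\<^sub>0 + t *\<^sub>R w) w"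
      using MVT2[of 0 1 ?G "\<lambda>t. Q (u\<^sub>0 + t *\<^sub>R w) w"] deriv by auto
    have "c * (norm w)\<^sup>2 \<le> Q (u\<^sub>0 + t *\<^sub>R w) w"
    proof (cases "w = 0")
      case True
      then show ?thesis
        using nn by simp
    next
      case False
      define v where "v = (1 / norm w) *\<^sub>R w"
      have "norm (t *\<^sub>R w) \<le> R"
        using t u(1) by (simp add: w_def mult_le_one order_trans[OF mult_left_le_one_le])
      then have "u\<^sub>0 + t *\<^sub>R w \<in> cball u\<^sub>0 R"
        by (simp add: dist_norm)
      moreover have "v \<in> S"
        using False u(2) by (simp add: S_def v_def w_def flip: sum_divide_distrib)
      ultimately have "c \<le> Q (u\<^sub>0 + t *\<^sub>R w) v"
        using c(2) by blast
      moreover have "w = norm w *\<^sub>R v"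
        using False by (simp add: v_def)
      ultimately show ?thesis
        using hom[of _ "norm w" v] by (metis mult.commute mult_left_mono zero_le_power2)
    qed
    also have "\<dots> = ?G 1 - ?G 0"
      using t by simp
    finally show "c * (norm (u - u\<^sub>0))\<^sup>2 \<le>
      (\<Sum>i\<in>UNIV. (gauss_curvature F \<Phi> (radii u) i - gauss_curvature F \<Phi> (radii u\<^sub>0) i) * (u - u\<^sub>0) $ i)"
      by (simp add: w_def sum_subtractf left_diff_distrib)
  qed
qed

section \<open>Convergence of the flow\<close>

lemma triangle_angle_scale:
  "0 < k \<Longrightarrow> triangle_angle (k * a) (k * b) (k * c) = triangle_angle a b c"
proof -
  assume k: "0 < k"
  have "((k * a)\<^sup>2 + (k * b)\<^sup>2 - (k * c)\<^sup>2) / (2 * (k * a) * (k * b)) =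
     (k\<^sup>2 * (a\<^sup>2 + b\<^sup>2 - c\<^sup>2)) / (k\<^sup>2 * (2 * a * b))"
    by (simp add: power_mult_distrib algebra_simps power2_eq_square)
  then show ?thesis
    using k by (simp add: triangle_angle_def)
qed

lemma gauss_curvature_scale:
  assumes "0 < k"
  shows "gauss_curvature F \<Phi> (k *\<^sub>R r) i = gauss_curvature F \<Phi> r i"
proof -
  have "edge_length \<Phi> (k *\<^sub>R r) i j = k * edge_length \<Phi> r i j" for i j
  proof -
    have "(k * r $ i)\<^sup>2 + (k * r $ j)\<^sup>2 + 2 * (k * r $ i) * (k * r $ j) * cos (\<Phi> {i, j}) =
        k\<^sup>2 * ((r $ i)\<^sup>2 + (r $ j)\<^sup>2 + 2 * r $ i * r $ j * cos (\<Phi> {i, j}))"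
      by algebra
    then show ?thesis
      using assms by (simp add: edge_length_def real_sqrt_mult)
  qed
  then have "inner_angle \<Phi> (k *\<^sub>R r) = inner_angle \<Phi> r"
    using assms by (simp add: fun_eq_iff inner_angle_def triangle_angle_scale)
  then show ?thesis
    by (simp add: gauss_curvature_def face_angle_def)
qed

lemma constant_alpha_curvature_scale:
  assumes "0 < k" "constant_alpha_curvature_metric F \<Phi> \<alpha> r"
  shows "constant_alpha_curvature_metric F \<Phi> \<alpha> (k *\<^sub>R r)"
proof -
  obtain c where c: "\<And>i. alpha_curvature F \<Phi> \<alpha> r i = c" and r: "\<And>i. 0 < r $ i"
    using assms(2) by (auto simp: constant_alpha_curvature_metric_def circle_packing_metric_def)
  have "alpha_curvature F \<Phi> \<alpha> (k *\<^sub>R r) i = c / k powr \<alpha>" for i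
    using c[of i] r[of i] assms(1)
    by (simp add: alpha_curvature_def gauss_curvature_scale powr_mult field_simps)
  then show ?thesis
    using r assms(1) by (auto simp: constant_alpha_curvature_metric_def circle_packing_metric_def)
qed

text \<open>
  The Gauss--Bonnet hypothesis forces the constant to be \<open>s_alpha E F \<alpha> r\<close>: sum \<open>K\<^sub>i = c r\<^sub>i\<^sup>\<alpha>\<close> over
  all vertices.
\<close>

lemma constant_alpha_curvature_iff_stationary:
  assumes "circle_packing_metric r" "(\<Sum>i\<in>UNIV. gauss_curvature F \<Phi> r i) = 2 * pi * euler_char E F"
  shows "constant_alpha_curvature_metric F \<Phi> \<alpha> r \<longleftrightarrow>
    (\<forall>i. gauss_curvature F \<Phi> r i = s_alpha E F \<alpha> r * (r $ i) powr \<alpha>)"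
proof
  have r: "0 < r $ i" for i
    using assms(1) by (simp add: circle_packing_metric_def)
  have Z: "0 < (\<Sum>i\<in>UNIV. (r $ i) powr \<alpha>)"
    using r by (intro sum_pos) (auto simp: less_imp_neq[THEN not_sym])
  show "\<forall>i. gauss_curvature F \<Phi> r i = s_alpha E F \<alpha> r * (r $ i) powr \<alpha>"
    if "constant_alpha_curvature_metric F \<Phi> \<alpha> r"
  proof -
    from that have "\<exists>c. \<forall>i. alpha_curvature F \<Phi> \<alpha> r i = c"
      unfolding constant_alpha_curvature_metric_def by (rule conjunct2)
    then obtain c where const: "\<forall>i. alpha_curvature F \<Phi> \<alpha> r i = c" ..
    have c: "gauss_curvature F \<Phi> r i = c * (r $ i) powr \<alpha>" for i
      using const[rule_format, of i] r[of i] by (auto simp: alpha_curvature_def divide_eq_eq)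
    then have "2 * pi * euler_char E F = c * (\<Sum>i\<in>UNIV. (r $ i) powr \<alpha>)"
      unfolding assms(2)[symmetric] by (simp add: sum_distrib_left)
    then have "s_alpha E F \<alpha> r = c"
      using Z by (simp add: s_alpha_def)
    then show ?thesis
      using c by simp
  qed
  show "constant_alpha_curvature_metric F \<Phi> \<alpha> r"
    if "\<forall>i. gauss_curvature F \<Phi> r i = s_alpha E F \<alpha> r * (r $ i) powr \<alpha>"
  proof -
    have "alpha_curvature F \<Phi> \<alpha> r i = s_alpha E F \<alpha> r" for i
      using that r[of i] by (simp add: alpha_curvature_def)
    then show ?thesis
      using assms(1) by (auto simp: constant_alpha_curvature_metric_def)
  qed
qed

text \<open>
  The weights \<open>p\<close> have sum one and \<open>x i = ln (p x i) + ln (Z x)\<close>. The normalizing constants cancel in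
  the sum, and what remains pairs the differences of \<open>p\<close> with those of the increasing function \<open>ln p\<close>.
\<close>

lemma softmax_monotone:
  fixes x y :: "'v::finite \<Rightarrow> real"
  shows "0 \<le> (\<Sum>i\<in>UNIV. (exp (x i) / (\<Sum>j\<in>UNIV. exp (x j)) - exp (y i) / (\<Sum>j\<in>UNIV. exp (y j))) * (x i - y i))"
proof -
  define Z where "Z x = (\<Sum>j\<in>(UNIV :: 'v set). exp (x j :: real))" for x
  define p where "p x i = exp (x i) / Z x" for x i
  have Z: "0 < Z x" for x
    unfolding Z_def by (intro sum_pos) auto
  have p: "0 < p x i" "ln (p x i) = x i - ln (Z x)" for x i
    using Z[of x] by (simp_all add: p_def ln_div)
  have sum_p: "(\<Sum>i\<in>UNIV. p x i) = 1" for x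
    using Z[of x] unfolding p_def sum_divide_distrib[symmetric] by (simp add: Z_def)
  have "0 \<le> (p x i - p y i) * (ln (p x i) - ln (p y i))" for i
    using p(1)[of x i] p(1)[of y i] by (cases "p x i \<le> p y i") (auto intro: mult_nonneg_nonneg mult_nonpos_nonpos)
  then have "0 \<le> (\<Sum>i\<in>UNIV. (p x i - p y i) * (ln (p x i) - ln (p y i)))"
    by (simp add: sum_nonneg)
  also have "\<dots> = (\<Sum>i\<in>UNIV. (p x i - p y i) * (x i - y i) - (p x i - p y i) * (ln (Z x) - ln (Z y)))"
    by (intro sum.cong) (auto simp: p(2) algebra_simps)
  also have "\<dots> = (\<Sum>i\<in>UNIV. (p x i - p y i) * (x i - y i))"
    by (simp add: sum_subtractf sum_p flip: sum_distrib_right)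
  finally show ?thesis
    by (simp add: p_def Z_def)
qed

text \<open>
  In logarithmic coordinates \<open>s\<^sub>\<alpha> r\<^sub>i\<^sup>\<alpha>\<close> is \<open>2\<pi>\<chi>\<close> times the softmax of \<open>\<alpha> u\<close>, which is monotone in
  \<open>\<alpha> u\<close>; the sign condition on \<open>\<alpha>\<chi>\<close> makes the product antitone in \<open>u\<close>.
\<close>

lemma area_term_antitone:
  assumes "\<alpha> * real_of_int (euler_char E F) \<le> 0"
  shows "(\<Sum>i\<in>UNIV. (s_alpha E F \<alpha> (radii u) * (radii u $ i) powr \<alpha> -
      s_alpha E F \<alpha> (radii v) * (radii v $ i) powr \<alpha>) * (u - v) $ i) \<le> 0"
proof -
  define p where "p w i = exp (\<alpha> * w $ i) / (\<Sum>j\<in>UNIV. exp (\<alpha> * w $ j))" for w :: "real ^ 'a" and i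
  define T where "T = (\<Sum>i\<in>UNIV. (p u i - p v i) * (u - v) $ i)"
  have s: "s_alpha E F \<alpha> (radii w) * (radii w $ i) powr \<alpha> = 2 * pi * euler_char E F * p w i" for w i
    by (simp add: s_alpha_def radii_def p_def powr_def)
  have eq: "(\<Sum>i\<in>UNIV. (s_alpha E F \<alpha> (radii u) * (radii u $ i) powr \<alpha> -
      s_alpha E F \<alpha> (radii v) * (radii v $ i) powr \<alpha>) * (u - v) $ i) = 2 * pi * euler_char E F * T"
    unfolding s T_def sum_distrib_left by (intro sum.cong) (auto simp: algebra_simps)
  have mono: "0 \<le> \<alpha> * T"
    using softmax_monotone[of "\<lambda>i. \<alpha> * u $ i" "\<lambda>i. \<alpha> * v $ i"]
    by (simp add: T_def p_def sum_distrib_left algebra_simps)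
  have "euler_char E F * T \<le> 0"
  proof (cases "\<alpha> = 0")
    case True
    then show ?thesis
      by (simp add: T_def p_def)
  next
    case False
    have "\<alpha>\<^sup>2 * (euler_char E F * T) = (\<alpha> * euler_char E F) * (\<alpha> * T)"
      by (simp add: power2_eq_square)
    also have "\<dots> \<le> 0"
      using assms mono by (rule mult_nonpos_nonneg)
    finally show ?thesis
      using False by (simp add: mult_le_0_iff)
  qed
  then show ?thesis
    unfolding eq by (simp add: mult_le_0_iff mult.assoc)
qed

lemma nonincreasing_of_deriv_nonpos:
  fixes f f' :: "real \<Rightarrow> real"
  assumes "\<And>t. 0 \<le> t \<Longrightarrow> (f has_real_derivative f' t) (at t within {0..})" "\<And>t. 0 \<le> t \<Longrightarrow> f' t \<le> 0" "0 \<le> t"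
  shows "f t \<le> f 0"
proof (rule DERIV_nonpos_imp_decreasing_open[OF \<open>0 \<le> t\<close>])
  show "\<exists>y. (f has_real_derivative y) (at x) \<and> y \<le> 0" if "0 < x" "x < t" for x
  proof -
    have "at x within {0..} = at x"
      using that by (intro at_within_interior) auto
    then show ?thesis
      using assms(1,2)[of x] that by auto
  qed
  have "continuous_on {0..} f"
    using assms(1) by (intro DERIV_continuous_on) auto
  then show "continuous_on {0..t} f"
    by (rule continuous_on_subset) auto
qed

text \<open>
  By the mean value theorem \<open>f (t + 1) - f t\<close> is a value of \<open>f'\<close> beyond \<open>t\<close>; it tends to \<open>0\<close> and
  to \<open>c\<close>.
\<close>

lemma limit_of_derivative_eq_0:
  fixes f f' :: "real \<Rightarrow> real"
  assumes "\<And>t. 0 < t \<Longrightarrow> (f has_real_derivative f' t) (at t)"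
    and "(f \<longlongrightarrow> L) at_top" "(f' \<longlongrightarrow> c) at_top"
  shows "c = 0"
proof -
  have "\<exists>\<xi>. t < \<xi> \<and> f (t + 1) - f t = f' \<xi>" if "0 < t" for t
    using MVT2[of t "t + 1" f f'] assms(1) that by fastforce
  then obtain \<xi> where \<xi>: "\<And>t. 0 < t \<Longrightarrow> t < \<xi> t \<and> f (t + 1) - f t = f' (\<xi> t)"
    by metis
  have shift: "filterlim (\<lambda>t::real. t + 1) at_top at_top"
    using filterlim_tendsto_add_at_top[OF tendsto_const filterlim_ident, of "1::real"] by (simp add: add.commute)
  have "((\<lambda>t. f (t + 1) - f t) \<longlongrightarrow> L - L) at_top"
    by (intro tendsto_diff filterlim_compose[OF assms(2) shift] assms(2))
  moreover have ev: "\<forall>\<^sub>F t::real in at_top. 0 < t"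
    by (rule eventually_gt_at_top)
  have "filterlim \<xi> at_top at_top"
  proof (rule filterlim_at_top_mono[OF filterlim_ident])
    show "\<forall>\<^sub>F t in at_top. t \<le> \<xi> t"
      using ev by eventually_elim (use \<xi> in \<open>simp add: less_imp_le\<close>)
  qed
  then have "((\<lambda>t. f' (\<xi> t)) \<longlongrightarrow> c) at_top"
    by (rule filterlim_compose[OF assms(3)])
  then have "((\<lambda>t. f (t + 1) - f t) \<longlongrightarrow> c) at_top"
  proof (rule Lim_transform_eventually)
    show "\<forall>\<^sub>F t in at_top. f' (\<xi> t) = f (t + 1) - f t"
      using ev by eventually_elim (use \<xi> in simp)
  qed
  ultimately show ?thesis
    using tendsto_unique[OF trivial_limit_at_top_linorder] by fastforce
qed

lemma exp_diff_le: "\<bar>exp x - exp y\<bar> \<le> exp (max x y) * \<bar>x - y\<bar>" for x y :: real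
proof -
  have "exp x - exp y \<le> exp x * (x - y)" for x y :: real
  proof -
    have "exp x * (1 + (y - x)) \<le> exp x * exp (y - x)"
      by (intro mult_left_mono exp_ge_add_one_self) auto
    then show ?thesis
      by (simp add: algebra_simps flip: exp_add)
  qed
  from this[of x y] this[of y x] show ?thesis
    by (cases "x \<le> y") (auto simp: max_def abs_if)
qed

lemma radii_dist_le:
  fixes u v :: "real ^ 'v::finite"
  assumes "norm (u - v) \<le> R"
  shows "dist (radii u) (radii v) \<le> (\<Sum>i\<in>UNIV. exp (v $ i + R)) * norm (u - v)"
proof -
  have "dist (radii u) (radii v) \<le> (\<Sum>i\<in>UNIV. \<bar>(radii u - radii v) $ i\<bar>)"
    unfolding dist_norm by (rule norm_le_l1_cart)
  also have "\<dots> \<le> (\<Sum>i\<in>UNIV. exp (v $ i + R) * norm (u - v))"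
  proof (rule sum_mono)
    fix i
    have c: "\<bar>u $ i - v $ i\<bar> \<le> norm (u - v)"
      using component_le_norm_cart[of "u - v" i] by simp
    then have "max (u $ i) (v $ i) \<le> v $ i + R"
      using assms by (auto simp: abs_le_iff)
    then have "exp (max (u $ i) (v $ i)) * \<bar>u $ i - v $ i\<bar> \<le> exp (v $ i + R) * norm (u - v)"
      using c by (intro mult_mono) auto
    then show "\<bar>(radii u - radii v) $ i\<bar> \<le> exp (v $ i + R) * norm (u - v)"
      using exp_diff_le[of "u $ i" "v $ i"] by (simp add: radii_def)
  qed
  finally show ?thesis
    by (simp add: sum_distrib_right)
qed

lemma flow_limit_stationary:
  assumes "simplicial_2_complex E F" "nonobtuse_weights E \<Phi>"
    and flow: "alpha_flow_solution E F \<Phi> \<alpha> r" and lim: "flow_converges_to r r'"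
  shows "gauss_curvature F \<Phi> r' i = s_alpha E F \<alpha> r' * (r' $ i) powr \<alpha>"
proof -
  have r': "circle_packing_metric r'" "\<And>i. 0 < r' $ i" "(r \<longlongrightarrow> r') at_top"
    using lim by (auto simp: flow_converges_to_def circle_packing_metric_def)
  let ?V = "\<lambda>r. s_alpha E F \<alpha> r * (r $ i) powr \<alpha> - gauss_curvature F \<Phi> r i"
  have "0 < (\<Sum>i\<in>UNIV. (r' $ i) powr \<alpha>)"
    using r'(2) by (intro sum_pos) (auto simp: less_imp_neq[THEN not_sym])
  then have "((\<lambda>t. ?V (r t)) \<longlongrightarrow> ?V r') at_top"
    unfolding s_alpha_def using r'(2)[THEN less_imp_neq, THEN not_sym]
    by (intro tendsto_intros gauss_curvature_tendsto[OF assms(1,2)] r'(1,3)) auto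
  moreover have "((\<lambda>t. ln (r t $ i)) \<longlongrightarrow> ln (r' $ i)) at_top"
    using r'(2)[of i] by (intro tendsto_intros r'(3)) auto
  moreover have "((\<lambda>\<tau>. ln (r \<tau> $ i)) has_real_derivative ?V (r t)) (at t)" if "0 < t" for t
  proof -
    have "at t within {0..} = at t"
      using that by (intro at_within_interior) auto
    then show ?thesis
      using flow that unfolding alpha_flow_solution_def by (metis less_imp_le)
  qed
  ultimately have "?V r' = 0"
    by (intro limit_of_derivative_eq_0[of "\<lambda>t. ln (r t $ i)" "\<lambda>t. ?V (r t)"])
  then show ?thesis
    by simp
qed

lemma exp_bound_converges:
  assumes "circle_packing_metric r'" "0 < C" "0 < c" "\<And>t. 0 \<le> t \<Longrightarrow> dist (r t) r' \<le> C * exp (- c * t)"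
  shows "flow_converges_exponentially_to r r'"
proof -
  have lim: "((\<lambda>t. C * exp (- c * t)) \<longlongrightarrow> 0) at_top"
  proof -
    have "filterlim (\<lambda>t. - c * t) at_bot at_top"
      using assms(3) by (intro filterlim_tendsto_neg_mult_at_bot[OF tendsto_const _ filterlim_ident]) auto
    from filterlim_compose[OF exp_at_bot this] show ?thesis
      by (rule tendsto_mult_right_zero)
  qed
  have bnd: "\<forall>\<^sub>F t in at_top. norm (dist (r t) r') \<le> C * exp (- c * t)"
    using eventually_ge_at_top[of "0::real"] by eventually_elim (use assms(4) in simp)
  have "((\<lambda>t. dist (r t) r') \<longlongrightarrow> 0) at_top"
    by (rule Lim_null_comparison[OF bnd lim])
  then have "(r \<longlongrightarrow> r') at_top"
    by (rule tendsto_dist_iff[THEN iffD2])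
  then show ?thesis
    using assms unfolding flow_converges_exponentially_to_def flow_converges_to_def by blast
qed

text \<open>
  The squared distance \<open>D\<close> of the logarithmic radii to the stationary point has, as \<open>V(u\<^sub>0) = 0\<close>,
  the derivative \<open>2 \<langle>V(u) - V(u\<^sub>0), u - u\<^sub>0\<rangle>\<close>. Monotonicity makes it nonincreasing, so the flow stays in a ball;
  on that ball the strong estimate holds with one constant \<open>c\<close>, and \<open>D' \<le> - 2 c D\<close>.
\<close>

lemma flow_contracts_to_stationary:
  fixes E F :: "'v::finite set set"
  assumes cpx: "simplicial_2_complex E F" "nonobtuse_weights E \<Phi>"
    and conn: "\<And>A. A \<noteq> {} \<Longrightarrow> A \<noteq> UNIV \<Longrightarrow> \<exists>f\<in>F. \<exists>a b. a \<in> f \<and> b \<in> f \<and> a \<in> A \<and> b \<notin> A"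
    and edges: "2 * card E = 3 * card F"
    and sign: "\<alpha> * real_of_int (euler_char E F) \<le> 0"
    and flow: "alpha_flow_solution E F \<Phi> \<alpha> r" and prod: "(\<Prod>i\<in>UNIV. r 0 $ i) = 1"
    and stat: "\<And>i. gauss_curvature F \<Phi> (radii u\<^sub>0) i = s_alpha E F \<alpha> (radii u\<^sub>0) * (radii u\<^sub>0 $ i) powr \<alpha>"
    and mean: "(\<Sum>i\<in>UNIV. u\<^sub>0 $ i) = 0"
  shows "flow_converges_exponentially_to r (radii u\<^sub>0)"
proof -
  have pos: "0 < r t $ i" if "0 \<le> t" for t i
    using flow that by (auto simp: alpha_flow_solution_def circle_packing_metric_def)
  define u where "u t = (\<chi> i. ln (r t $ i))" for t
  have ru: "radii (u t) = r t" if "0 \<le> t" for t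
    using pos[OF that] by (simp add: radii_def u_def vec_eq_iff)
  define V where "V w i = s_alpha E F \<alpha> (radii w) * (radii w $ i) powr \<alpha> - gauss_curvature F \<Phi> (radii w) i"
    for w i
  have deriv: "((\<lambda>t. u t $ i) has_real_derivative V (u t) i) (at t within {0..})" if "0 \<le> t" for t i
    using flow that ru[OF that] unfolding alpha_flow_solution_def V_def by (simp add: u_def)
  have sum_V: "(\<Sum>i\<in>UNIV. V w i) = 0" for w
  proof -
    have cp: "circle_packing_metric (radii w)"
      by (simp add: circle_packing_metric_def radii_def)
    have "0 < (\<Sum>i\<in>UNIV. (radii w $ i) powr \<alpha>)"
      by (intro sum_pos) (auto simp: radii_def)
    then have "(\<Sum>i\<in>UNIV. s_alpha E F \<alpha> (radii w) * (radii w $ i) powr \<alpha>) = 2 * pi * euler_char E F"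
      unfolding s_alpha_def sum_distrib_left[symmetric] by simp
    then show ?thesis
      using gauss_bonnet[OF cpx edges cp] by (simp add: V_def sum_subtractf)
  qed
  \<comment> \<open>The flow stays in the hyperplane on which the curvature is strongly monotone.\<close>
  have sum_u: "(\<Sum>i\<in>UNIV. u t $ i) = 0" if "0 \<le> t" for t
  proof -
    have d: "((\<lambda>t. \<Sum>i\<in>UNIV. u t $ i) has_real_derivative 0) (at t within {0..})" if "0 \<le> t" for t
    proof -
      have "((\<lambda>t. \<Sum>i\<in>UNIV. u t $ i) has_real_derivative (\<Sum>i\<in>UNIV. V (u t) i)) (at t within {0..})"
        by (intro DERIV_sum deriv that)
      then show ?thesis
        by (simp add: sum_V)
    qed
    have "(\<Sum>i\<in>UNIV. u t $ i) \<le> (\<Sum>i\<in>UNIV. u 0 $ i)"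
      using nonincreasing_of_deriv_nonpos[OF d _ that] by simp
    moreover have "- (\<Sum>i\<in>UNIV. u t $ i) \<le> - (\<Sum>i\<in>UNIV. u 0 $ i)"
      using nonincreasing_of_deriv_nonpos[OF DERIV_minus[OF d] _ that] by simp
    moreover have "r 0 $ i \<noteq> 0" for i
      using pos[of 0 i] by simp
    then have "(\<Sum>i\<in>UNIV. u 0 $ i) = ln (\<Prod>i\<in>UNIV. r 0 $ i)"
      by (simp add: u_def ln_prod)
    ultimately show ?thesis
      using prod by simp
  qed
  define D where "D t = (norm (u t - u\<^sub>0))\<^sup>2" for t
  define D' where "D' t = 2 * (\<Sum>i\<in>UNIV. V (u t) i * (u t - u\<^sub>0) $ i)" for t
  have D: "D t = (\<Sum>i\<in>UNIV. (u t $ i - u\<^sub>0 $ i)\<^sup>2)" for t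
    unfolding D_def power2_norm_eq_inner inner_vec_def by (simp add: power2_eq_square)
  have D_deriv: "(D has_real_derivative D' t) (at t within {0..})" if "0 \<le> t" for t
  proof -
    have "((\<lambda>t. \<Sum>i\<in>UNIV. (u t $ i - u\<^sub>0 $ i)\<^sup>2) has_real_derivative
        (\<Sum>i\<in>UNIV. 2 * (V (u t) i * (u t - u\<^sub>0) $ i))) (at t within {0..})"
    proof (rule DERIV_sum)
      fix i
      have "((\<lambda>t. u t $ i - u\<^sub>0 $ i) has_real_derivative V (u t) i - 0) (at t within {0..})"
        by (intro DERIV_diff deriv[OF that] DERIV_const)
      from DERIV_power[OF this, of 2]
      show "((\<lambda>t. (u t $ i - u\<^sub>0 $ i)\<^sup>2) has_real_derivative 2 * (V (u t) i * (u t - u\<^sub>0) $ i)) (at t within {0..})"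
        by (simp add: mult_ac)
    qed
    moreover have "D = (\<lambda>t. \<Sum>i\<in>UNIV. (u t $ i - u\<^sub>0 $ i)\<^sup>2)"
      using D by (rule ext)
    ultimately show ?thesis
      by (simp add: D'_def sum_distrib_left)
  qed
  have D'_le: "D' t \<le> - (2 * (c * D t))"
    if "0 \<le> t" "c * (norm (u t - u\<^sub>0))\<^sup>2 \<le>
      (\<Sum>i\<in>UNIV. (gauss_curvature F \<Phi> (radii (u t)) i - gauss_curvature F \<Phi> (radii u\<^sub>0) i) * (u t - u\<^sub>0) $ i)" for t c
  proof -
    have "(\<Sum>i\<in>UNIV. V (u t) i * (u t - u\<^sub>0) $ i) =
      (\<Sum>i\<in>UNIV. (s_alpha E F \<alpha> (radii (u t)) * (radii (u t) $ i) powr \<alpha> -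
        s_alpha E F \<alpha> (radii u\<^sub>0) * (radii u\<^sub>0 $ i) powr \<alpha>) * (u t - u\<^sub>0) $ i) -
      (\<Sum>i\<in>UNIV. (gauss_curvature F \<Phi> (radii (u t)) i - gauss_curvature F \<Phi> (radii u\<^sub>0) i) * (u t - u\<^sub>0) $ i)"
      unfolding V_def sum_subtractf[symmetric] stat by (intro sum.cong) (auto simp: algebra_simps)
    then show ?thesis
      using area_term_antitone[OF sign, of "u t" u\<^sub>0] that(2) by (simp add: D'_def D_def)
  qed
  have mean_diff: "(\<Sum>i\<in>UNIV. (u t - u\<^sub>0) $ i) = 0" if "0 \<le> t" for t
    using sum_u[OF that] mean by (simp add: sum_subtractf)
  define P where "P w = (\<Sum>i\<in>UNIV.
      (gauss_curvature F \<Phi> (radii w) i - gauss_curvature F \<Phi> (radii u\<^sub>0) i) * (w - u\<^sub>0) $ i)" for w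
  have strong: "\<exists>c>0. \<forall>w. norm (w - u\<^sub>0) \<le> R \<longrightarrow> (\<Sum>i\<in>UNIV. (w - u\<^sub>0) $ i) = 0 \<longrightarrow>
      c * (norm (w - u\<^sub>0))\<^sup>2 \<le> P w" for R
    unfolding P_def by (rule curvature_strongly_monotone[OF cpx conn, where R = R and u\<^sub>0 = u\<^sub>0]) blast+
  have "D' t \<le> 0" if t: "0 \<le> t" for t
  proof -
    obtain c where c: "0 < c" "c * (norm (u t - u\<^sub>0))\<^sup>2 \<le> P (u t)"
      using strong[of "norm (u t - u\<^sub>0)"] mean_diff[OF t] by blast
    have "0 \<le> c * D t"
      using c(1) by (simp add: D_def)
    then show ?thesis
      using D'_le[OF t c(2)[unfolded P_def]] by linarith
  qed
  then have "D t \<le> D 0" if "0 \<le> t" for t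
    using nonincreasing_of_deriv_nonpos[OF D_deriv _ that] by blast
  then have bounded: "norm (u t - u\<^sub>0) \<le> norm (u 0 - u\<^sub>0)" if "0 \<le> t" for t
    using that by (simp add: D_def abs_le_square_iff[symmetric])
  define R where "R = norm (u 0 - u\<^sub>0)"
  obtain c where c: "0 < c" "\<And>t. 0 \<le> t \<Longrightarrow> c * (norm (u t - u\<^sub>0))\<^sup>2 \<le> P (u t)"
    using strong[of R] mean_diff bounded unfolding R_def by blast
  have decay: "norm (u t - u\<^sub>0) \<le> R * exp (- c * t)" if "0 \<le> t" for t
  proof -
    have weighted: "((\<lambda>t. D t * exp (2 * c * t)) has_real_derivative (D' t + 2 * c * D t) * exp (2 * c * t))
        (at t within {0..})" if "0 \<le> t" for t
      by (auto intro!: derivative_eq_intros D_deriv[OF that] simp: algebra_simps)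
    have nonpos: "(D' t + 2 * c * D t) * exp (2 * c * t) \<le> 0" if "0 \<le> t" for t
      using D'_le[OF that c(2)[OF that, unfolded P_def]] by (simp add: mult_le_0_iff)
    have "D t * exp (2 * c * t) \<le> D 0 * exp (2 * c * 0)"
      by (rule nonincreasing_of_deriv_nonpos[OF weighted nonpos that])
    moreover have "exp (2 * c * t) = (exp (c * t))\<^sup>2"
      using exp_double[of "c * t"] by (simp add: mult.assoc)
    ultimately have "(norm (u t - u\<^sub>0) * exp (c * t))\<^sup>2 \<le> R\<^sup>2"
      by (simp add: D_def R_def power_mult_distrib)
    then have "norm (u t - u\<^sub>0) * exp (c * t) \<le> R"
      by (rule power2_le_imp_le) (simp add: R_def)
    then show ?thesis
      by (simp add: exp_minus field_simps)
  qed
  \<comment> \<open>The summand \<open>1\<close> only makes \<open>C\<close> positive when the flow starts at the stationary point.\<close>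
  define C where "C = (\<Sum>i\<in>UNIV. exp (u\<^sub>0 $ i + R)) * R + 1"
  have sum_nn: "0 \<le> (\<Sum>i\<in>UNIV. exp (u\<^sub>0 $ i + R))"
    by (intro sum_nonneg) auto
  show ?thesis
  proof (rule exp_bound_converges)
    show "circle_packing_metric (radii u\<^sub>0)"
      by (simp add: circle_packing_metric_def radii_def)
    show "0 < C"
      unfolding C_def using sum_nn by (intro add_nonneg_pos mult_nonneg_nonneg) (auto simp: R_def)
    show "0 < c"
      by fact
    fix t :: real assume t: "0 \<le> t"
    have "dist (r t) (radii u\<^sub>0) \<le> (\<Sum>i\<in>UNIV. exp (u\<^sub>0 $ i + R)) * norm (u t - u\<^sub>0)"
      using radii_dist_le[of "u t" u\<^sub>0 R] bounded[OF t] ru[OF t] by (simp add: R_def)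
    also have "\<dots> \<le> (\<Sum>i\<in>UNIV. exp (u\<^sub>0 $ i + R)) * (R * exp (- c * t))"
      using sum_nn decay[OF t] by (intro mult_left_mono) auto
    also have "\<dots> \<le> C * exp (- c * t)"
      by (simp add: C_def algebra_simps)
    finally show "dist (r t) (radii u\<^sub>0) \<le> C * exp (- c * t)" .
  qed
qed

lemma log_radii_normalization:
  fixes r :: "real ^ 'v::finite"
  assumes "circle_packing_metric r"
  obtains k u where "0 < k" "k *\<^sub>R r = radii u" "(\<Sum>i\<in>UNIV. u $ i) = 0"
proof
  define m where "m = (\<Sum>i\<in>UNIV. ln (r $ i)) / CARD('v)"
  show "0 < exp (- m)"
    by simp
  show "exp (- m) *\<^sub>R r = radii (\<chi> i. ln (r $ i) - m)"
    using assms by (simp add: vec_eq_iff radii_def circle_packing_metric_def exp_diff exp_minus field_simps)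
  show "(\<Sum>i\<in>UNIV. (\<chi> i. ln (r $ i) - m) $ i) = 0"
    by (simp add: sum_subtractf m_def)
qed

text \<open>
  A limit of the flow is stationary, hence of constant curvature. Conversely a metric of constant
  curvature may be rescaled to lie on the hyperplane of the flow, where it attracts the flow.
\<close>

theorem theorem2p7:
  fixes M :: "'m topology"
    and E F :: "'v::finite set set"
    and \<Phi> :: "'v set \<Rightarrow> real"
    and \<alpha> :: real
    and r :: "real \<Rightarrow> real ^ 'v"
  assumes "weighted_triangulated_surface M E F \<Phi>"
    and "connected_space M"
    and "\<alpha> * real_of_int (euler_char E F) \<le> 0"
    and "circle_packing_metric (r 0)"
    and "(\<Prod>i\<in>UNIV. r 0 $ i) = 1"
    and "alpha_flow_solution E F \<Phi> \<alpha> r"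
  shows "((\<exists>r'. flow_converges_to r r') \<longleftrightarrow>
            (\<exists>r'. constant_alpha_curvature_metric F \<Phi> \<alpha> r')) \<and>
         ((\<exists>r'. flow_converges_to r r') \<longrightarrow>
            (\<exists>r'. flow_converges_exponentially_to r r' \<and>
                  constant_alpha_curvature_metric F \<Phi> \<alpha> r'))"
proof -
  have M: "closed_surface M" "triangulates E F M" and cpx: "simplicial_2_complex E F" "nonobtuse_weights E \<Phi>"
    using assms(1) by (auto simp: weighted_triangulated_surface_def triangulates_def nonobtuse_weights_def)
  note edges = two_edges_eq_three_faces[OF M]
  note stationary_iff = constant_alpha_curvature_iff_stationary[OF _ gauss_bonnet[OF cpx edges]]
  have limit: "constant_alpha_curvature_metric F \<Phi> \<alpha> r'" if "flow_converges_to r r'" for r'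
  proof -
    have "circle_packing_metric r'"
      using that by (simp add: flow_converges_to_def)
    then show ?thesis
      using stationary_iff flow_limit_stationary[OF cpx assms(6) that] by blast
  qed
  have attract: "\<exists>r'. flow_converges_exponentially_to r r' \<and> constant_alpha_curvature_metric F \<Phi> \<alpha> r'"
    if const: "constant_alpha_curvature_metric F \<Phi> \<alpha> r'" for r'
  proof -
    obtain k u\<^sub>0 where k: "0 < k" "k *\<^sub>R r' = radii u\<^sub>0" "(\<Sum>i\<in>UNIV. u\<^sub>0 $ i) = 0"
      using const log_radii_normalization by (auto simp: constant_alpha_curvature_metric_def)
    have const': "constant_alpha_curvature_metric F \<Phi> \<alpha> (radii u\<^sub>0)"
      using constant_alpha_curvature_scale[OF k(1) const] k(2) by simp
    then have "gauss_curvature F \<Phi> (radii u\<^sub>0) i = s_alpha E F \<alpha> (radii u\<^sub>0) * (radii u\<^sub>0 $ i) powr \<alpha>" for i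
      using stationary_iff by (auto simp: constant_alpha_curvature_metric_def)
    then have "flow_converges_exponentially_to r (radii u\<^sub>0)"
      by (intro flow_contracts_to_stationary[OF cpx face_across_cut[OF M assms(2)] edges assms(3,6,5) _ k(3)])
    then show ?thesis
      using const' by blast
  qed
  then show ?thesis
    using limit unfolding flow_converges_exponentially_to_def by blast
qed

end
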